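(* Let $S$ be a semiring. There is an equivalence (natural isomorphism) of functors $$-\boxtimes_S-\;\approx\;\mathfrak{c}(-)\circ(-\otimes_S-):\ \mathbb{S}_S\times{}_S\mathbb{S}\longrightarrow \mathbf{CAbMon}.$$ In particular, for every right $S$-semimodule $M$ and every left $S$-semimodule $N$ there is a natural isomorphism of Abelian monoids $$M\boxtimes_S N\simeq \mathfrak{c}(M\otimes_S N).$$
   Context: A semiring $(S,+,\cdot,0,1)$ consists of a commutative monoid $(S,+,0)$ and a monoid $(S,\cdot,1)$ such that $\cdot$ distributes over $+$ on both sides and $0s=0=s0$ for all $s$; throughout $1\neq 0$. A right $S$-semimodule is a commutative monoid $(M,+,0)$ with a map $M\times S\to M$ such that $(ms)s'=m(ss')$, $(m+m')s=ms+m's$, $m(s+s')=ms+ms'$, $m1=m$, $m0=0=0s$; left semimodules are defined analogously. $\mathbb{S}_S$ and ${}_S\mathbb{S}$ denote the categories of right and left $S$-semimodules with $S$-linear (additive, action-preserving) maps. $\mathbf{CAbMon}$ is the category of cancellative Abelian monoids. For an Abelian monoid $G$, a map $\beta:M\times N\to G$ is $S$-balanced if it is bilinear (a monoid morphism in each variable) and $\beta(ms,n)=\beta(m,sn)$. The tensor product $M\otimes_S N$ is the Abelian monoid with an $S$-balanced map $\tau:M\times N\to M\otimes_S N$ such that every $S$-balanced map $\beta:M\times N\to G$ to an Abelian monoid $G$ factors as $\beta=\gamma\circ\tau$ for a unique monoid morphism $\gamma$. For an Abelian monoid $A$, $\mathfrak{c}(A)=A/\!\equiv_{[0]}$, where $a\equiv_{[0]}a'$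 iff $a+a''=a'+a''$ for some $a''\in A$; this is a cancellative monoid and defines a functor $\mathfrak{c}$ from Abelian monoids to $\mathbf{CAbMon}$. Takahashi's tensor product $M\boxtimes_S N$: let $F$ be the free Abelian monoid with basis $\{\delta_{(m,n)}\mid (m,n)\in M\times N\}$ and let $N(M)\subseteq F\times F$ be the symmetric submonoid generated by the pairs $(\delta_{(m_1+m_2,n)},\delta_{(m_1,n)}+\delta_{(m_2,n)})$, $(\delta_{(m,n_1+n_2)},\delta_{(m,n_1)}+\delta_{(m,n_2)})$, $(\delta_{(ms,n)},\delta_{(m,sn)})$ and the pairs obtained from these by swapping the two components. Define a congruence on $F$ by $f\,\rho\, g$ iff $f+h=g+h'$ for some $(h,h')\in N(M)$, and set $M\boxtimes_S N=F/\rho$. It comes with the $S$-balanced map $\widetilde\tau(m,n)=$ class of $\delta_{(m,n)}$, and is universal for $S$-balanced maps from $M\times N$ into cancellative Abelian monoids. On morphisms, $-\otimes_S-$ and $-\boxtimes_S-$ act via these universal properties. *)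

theory Defs
  imports "HOL-Algebra.Ring" "HOL-Algebra.Divisibility"
begin

text \<open>
  Abelian monoids are \<open>comm_monoid\<close>s of HOL-Algebra, so their addition and zero are written
  \<open>\<otimes>\<close> and \<open>\<one>\<close>.  Semirings are \<open>semiring\<close>s of HOL-Algebra (with \<open>\<oplus>\<close>, \<open>\<zero>\<close>, \<open>\<otimes>\<close>, \<open>\<one>\<close>).
  The library's \<open>hom\<close> does not ask for preservation of the neutral element.  All arrows are
  functions that are \<open>undefined\<close> outside the carrier of their source, so that equality of arrows is
  equality on the carrier.
\<close>

definition monoid_hom :: "('a, 'x) monoid_scheme \<Rightarrow> ('b, 'y) monoid_scheme \<Rightarrow> ('a \<Rightarrow> 'b) set" where
  "monoid_hom A B = {h \<in> hom A B. h \<one>\<^bsub>A\<^esub> = \<one>\<^bsub>B\<^esub>}"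

definition monoid_arr :: "('a, 'x) monoid_scheme \<Rightarrow> ('b, 'y) monoid_scheme \<Rightarrow> ('a \<Rightarrow> 'b) set" where
  "monoid_arr A B = monoid_hom A B \<inter> extensional (carrier A)"


section \<open>Categories and functors\<close>

record ('o, 'a) cat =
  Obj :: "'o set"
  Arr :: "'o \<Rightarrow> 'o \<Rightarrow> 'a set"
  Ident :: "'o \<Rightarrow> 'a"
  Comp :: "'o \<Rightarrow> 'o \<Rightarrow> 'o \<Rightarrow> 'a \<Rightarrow> 'a \<Rightarrow> 'a"  \<comment> \<open>\<open>Comp C X Y Z g f\<close> is \<open>g \<circ> f\<close> for \<open>f : X \<rightarrow> Y\<close>, \<open>g : Y \<rightarrow> Z\<close>\<close>

definition is_category :: "('o, 'a) cat \<Rightarrow> bool" where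
  "is_category C \<longleftrightarrow>
    (\<forall>X \<in> Obj C. Ident C X \<in> Arr C X X) \<and>
    (\<forall>X \<in> Obj C. \<forall>Y \<in> Obj C. \<forall>Z \<in> Obj C. \<forall>f \<in> Arr C X Y. \<forall>g \<in> Arr C Y Z.
       Comp C X Y Z g f \<in> Arr C X Z) \<and>
    (\<forall>X \<in> Obj C. \<forall>Y \<in> Obj C. \<forall>f \<in> Arr C X Y.
       Comp C X Y Y (Ident C Y) f = f \<and> Comp C X X Y f (Ident C X) = f) \<and>
    (\<forall>W \<in> Obj C. \<forall>X \<in> Obj C. \<forall>Y \<in> Obj C. \<forall>Z \<in> Obj C.
       \<forall>f \<in> Arr C W X. \<forall>g \<in> Arr C X Y. \<forall>h \<in> Arr C Y Z.
       Comp C W X Z (Comp C X Y Z h g) f = Comp C W Y Z h (Comp C W X Y g f))"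

definition prod_cat :: "('o, 'a) cat \<Rightarrow> ('p, 'b) cat \<Rightarrow> ('o \<times> 'p, 'a \<times> 'b) cat" (infixr "\<times>\<^sub>C" 75) where
  "C \<times>\<^sub>C D =
    \<lparr> Obj = Obj C \<times> Obj D,
      Arr = (\<lambda>X Y. Arr C (fst X) (fst Y) \<times> Arr D (snd X) (snd Y)),
      Ident = (\<lambda>X. (Ident C (fst X), Ident D (snd X))),
      Comp = (\<lambda>X Y Z g f. (Comp C (fst X) (fst Y) (fst Z) (fst g) (fst f),
                           Comp D (snd X) (snd Y) (snd Z) (snd g) (snd f))) \<rparr>"

record ('o, 'a, 'p, 'b) fctr =
  omap :: "'o \<Rightarrow> 'p"
  amap :: "'o \<Rightarrow> 'o \<Rightarrow> 'a \<Rightarrow> 'b"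

definition is_fctr :: "('o, 'a) cat \<Rightarrow> ('p, 'b) cat \<Rightarrow> ('o, 'a, 'p, 'b) fctr \<Rightarrow> bool" where
  "is_fctr C D F \<longleftrightarrow>
    (\<forall>X \<in> Obj C. omap F X \<in> Obj D) \<and>
    (\<forall>X \<in> Obj C. \<forall>Y \<in> Obj C. \<forall>f \<in> Arr C X Y. amap F X Y f \<in> Arr D (omap F X) (omap F Y)) \<and>
    (\<forall>X \<in> Obj C. amap F X X (Ident C X) = Ident D (omap F X)) \<and>
    (\<forall>X \<in> Obj C. \<forall>Y \<in> Obj C. \<forall>Z \<in> Obj C. \<forall>f \<in> Arr C X Y. \<forall>g \<in> Arr C Y Z.
       amap F X Z (Comp C X Y Z g f)
       = Comp D (omap F X) (omap F Y) (omap F Z) (amap F Y Z g) (amap F X Y f))"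

definition fctr_comp :: "('p, 'b, 'q, 'c) fctr \<Rightarrow> ('o, 'a, 'p, 'b) fctr \<Rightarrow> ('o, 'a, 'q, 'c) fctr"
    (infixr "\<circ>\<^sub>F" 75) where
  "G \<circ>\<^sub>F F =
    \<lparr> omap = (\<lambda>X. omap G (omap F X)),
      amap = (\<lambda>X Y f. amap G (omap F X) (omap F Y) (amap F X Y f)) \<rparr>"

definition AbMon :: "('a monoid, 'a \<Rightarrow> 'a) cat" where
  "AbMon =
    \<lparr> Obj = {A. comm_monoid A},
      Arr = monoid_arr,
      Ident = (\<lambda>A. \<lambda>x \<in> carrier A. x),
      Comp = (\<lambda>A B C g f. compose (carrier A) g f) \<rparr>"

definition CAbMon :: "('a monoid, 'a \<Rightarrow> 'a) cat" where
  "CAbMon = AbMon \<lparr> Obj := {A. comm_monoid_cancel A} \<rparr>"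

text \<open>
  Two functors into cancellative Abelian monoids whose values live in different types \<open>'x\<close> and
  \<open>'y\<close>: the two copies of \<open>CAbMon\<close> are one category split over HOL types, and the components of the
  transformation are monoid homomorphisms from type \<open>'x\<close> to type \<open>'y\<close>.
\<close>

definition CAbMon_natural_iso ::
    "('o, 'a) cat \<Rightarrow> ('o, 'a, 'x monoid, 'x \<Rightarrow> 'x) fctr \<Rightarrow> ('o, 'a, 'y monoid, 'y \<Rightarrow> 'y) fctr
      \<Rightarrow> ('o \<Rightarrow> 'x \<Rightarrow> 'y) \<Rightarrow> bool" where
  "CAbMon_natural_iso C F G \<eta> \<longleftrightarrow>
    is_fctr C CAbMon F \<and> is_fctr C CAbMon G \<and>
    (\<forall>X \<in> Obj C. \<eta> X \<in> monoid_arr (omap F X) (omap G X) \<inter> iso (omap F X) (omap G X)) \<and>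
    (\<forall>X \<in> Obj C. \<forall>Y \<in> Obj C. \<forall>f \<in> Arr C X Y.
       compose (carrier (omap F X)) (\<eta> Y) (amap F X Y f)
       = compose (carrier (omap F X)) (amap G X Y f) (\<eta> X))"


section \<open>Semimodules\<close>

record ('s, 'm) rsemimod = "'m monoid" +
  ract :: "'m \<Rightarrow> 's \<Rightarrow> 'm"

record ('s, 'n) lsemimod = "'n monoid" +
  lact :: "'s \<Rightarrow> 'n \<Rightarrow> 'n"

locale right_semimodule =
  S: semiring S + comm_monoid M
  for S :: "('s, 'z) ring_scheme" and M :: "('s, 'm) rsemimod" +
  assumes ract_closed: "\<lbrakk>m \<in> carrier M; s \<in> carrier S\<rbrakk> \<Longrightarrow> ract M m s \<in> carrier M"
    and ract_assoc: "\<lbrakk>m \<in> carrier M; s \<in> carrier S; s' \<in> carrier S\<rbrakk>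
      \<Longrightarrow> ract M (ract M m s) s' = ract M m (s \<otimes>\<^bsub>S\<^esub> s')"
    and ract_add_left: "\<lbrakk>m \<in> carrier M; m' \<in> carrier M; s \<in> carrier S\<rbrakk>
      \<Longrightarrow> ract M (m \<otimes>\<^bsub>M\<^esub> m') s = ract M m s \<otimes>\<^bsub>M\<^esub> ract M m' s"
    and ract_add_right: "\<lbrakk>m \<in> carrier M; s \<in> carrier S; s' \<in> carrier S\<rbrakk>
      \<Longrightarrow> ract M m (s \<oplus>\<^bsub>S\<^esub> s') = ract M m s \<otimes>\<^bsub>M\<^esub> ract M m s'"
    and ract_one: "m \<in> carrier M \<Longrightarrow> ract M m \<one>\<^bsub>S\<^esub> = m"
    and ract_zero_right: "m \<in> carrier M \<Longrightarrow> ract M m \<zero>\<^bsub>S\<^esub> = \<one>\<^bsub>M\<^esub>"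
    and ract_zero_left: "s \<in> carrier S \<Longrightarrow> ract M \<one>\<^bsub>M\<^esub> s = \<one>\<^bsub>M\<^esub>"

locale left_semimodule =
  S: semiring S + comm_monoid N
  for S :: "('s, 'z) ring_scheme" and N :: "('s, 'n) lsemimod" +
  assumes lact_closed: "\<lbrakk>n \<in> carrier N; s \<in> carrier S\<rbrakk> \<Longrightarrow> lact N s n \<in> carrier N"
    and lact_assoc: "\<lbrakk>n \<in> carrier N; s \<in> carrier S; s' \<in> carrier S\<rbrakk>
      \<Longrightarrow> lact N s (lact N s' n) = lact N (s \<otimes>\<^bsub>S\<^esub> s') n"
    and lact_add_right: "\<lbrakk>n \<in> carrier N; n' \<in> carrier N; s \<in> carrier S\<rbrakk>
      \<Longrightarrow> lact N s (n \<otimes>\<^bsub>N\<^esub> n') = lact N s n \<otimes>\<^bsub>N\<^esub> lact N s n'"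
    and lact_add_left: "\<lbrakk>n \<in> carrier N; s \<in> carrier S; s' \<in> carrier S\<rbrakk>
      \<Longrightarrow> lact N (s \<oplus>\<^bsub>S\<^esub> s') n = lact N s n \<otimes>\<^bsub>N\<^esub> lact N s' n"
    and lact_one: "n \<in> carrier N \<Longrightarrow> lact N \<one>\<^bsub>S\<^esub> n = n"
    and lact_zero_left: "n \<in> carrier N \<Longrightarrow> lact N \<zero>\<^bsub>S\<^esub> n = \<one>\<^bsub>N\<^esub>"
    and lact_zero_right: "s \<in> carrier S \<Longrightarrow> lact N s \<one>\<^bsub>N\<^esub> = \<one>\<^bsub>N\<^esub>"

definition rlinear_arr ::
    "('s, 'z) ring_scheme \<Rightarrow> ('s, 'm) rsemimod \<Rightarrow> ('s, 'm') rsemimod \<Rightarrow> ('m \<Rightarrow> 'm') set" where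
  "rlinear_arr S M M' = {f \<in> monoid_arr M M'.
     \<forall>m \<in> carrier M. \<forall>s \<in> carrier S. f (ract M m s) = ract M' (f m) s}"

definition llinear_arr ::
    "('s, 'z) ring_scheme \<Rightarrow> ('s, 'n) lsemimod \<Rightarrow> ('s, 'n') lsemimod \<Rightarrow> ('n \<Rightarrow> 'n') set" where
  "llinear_arr S N N' = {g \<in> monoid_arr N N'.
     \<forall>n \<in> carrier N. \<forall>s \<in> carrier S. g (lact N s n) = lact N' s (g n)}"

text \<open>The semimodules whose carrier is a subset of the (arbitrary) type \<open>'m\<close> respectively \<open>'n\<close>.\<close>

definition right_semimodules :: "('s, 'z) ring_scheme \<Rightarrow> (('s, 'm) rsemimod, 'm \<Rightarrow> 'm) cat" where
  "right_semimodules S =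
    \<lparr> Obj = {M. right_semimodule S M},
      Arr = rlinear_arr S,
      Ident = (\<lambda>M. \<lambda>x \<in> carrier M. x),
      Comp = (\<lambda>M M' M'' g f. compose (carrier M) g f) \<rparr>"

definition left_semimodules :: "('s, 'z) ring_scheme \<Rightarrow> (('s, 'n) lsemimod, 'n \<Rightarrow> 'n) cat" where
  "left_semimodules S =
    \<lparr> Obj = {N. left_semimodule S N},
      Arr = llinear_arr S,
      Ident = (\<lambda>N. \<lambda>x \<in> carrier N. x),
      Comp = (\<lambda>N N' N'' g f. compose (carrier N) g f) \<rparr>"


section \<open>Quotients of Abelian monoids and the cancellative reflection\<close>

definition quotient_monoid :: "('a, 'x) monoid_scheme \<Rightarrow> ('a \<times> 'a) set \<Rightarrow> 'a set monoid" where
  "quotient_monoid A r =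
    \<lparr> carrier = carrier A // r,
      monoid.mult = (\<lambda>X Y. \<Union>x \<in> X. \<Union>y \<in> Y. r `` {x \<otimes>\<^bsub>A\<^esub> y}),
      one = r `` {\<one>\<^bsub>A\<^esub>} \<rparr>"

definition cancel_rel :: "('a, 'x) monoid_scheme \<Rightarrow> ('a \<times> 'a) set" where
  "cancel_rel A = {(a, a'). a \<in> carrier A \<and> a' \<in> carrier A \<and>
     (\<exists>a'' \<in> carrier A. a \<otimes>\<^bsub>A\<^esub> a'' = a' \<otimes>\<^bsub>A\<^esub> a'')}"

definition cancel_monoid :: "('a, 'x) monoid_scheme \<Rightarrow> 'a set monoid" where
  "cancel_monoid A = quotient_monoid A (cancel_rel A)"

definition cancel_fctr :: "('a monoid, 'a \<Rightarrow> 'a, 'a set monoid, 'a set \<Rightarrow> 'a set) fctr" where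
  "cancel_fctr =
    \<lparr> omap = cancel_monoid,
      amap = (\<lambda>A B f. \<lambda>X \<in> carrier (cancel_monoid A). \<Union>a \<in> X. cancel_rel B `` {f a}) \<rparr>"


section \<open>Balanced maps\<close>

definition balanced ::
    "('s, 'z) ring_scheme \<Rightarrow> ('s, 'm) rsemimod \<Rightarrow> ('s, 'n) lsemimod \<Rightarrow> ('g, 'x) monoid_scheme
      \<Rightarrow> ('m \<Rightarrow> 'n \<Rightarrow> 'g) \<Rightarrow> bool" where
  "balanced S M N G \<beta> \<longleftrightarrow>
    (\<forall>n \<in> carrier N. (\<lambda>m. \<beta> m n) \<in> monoid_hom M G) \<and>
    (\<forall>m \<in> carrier M. (\<lambda>n. \<beta> m n) \<in> monoid_hom N G) \<and>
    (\<forall>m \<in> carrier M. \<forall>s \<in> carrier S. \<forall>n \<in> carrier N. \<beta> (ract M m s) n = \<beta> m (lact N s n))"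

definition factorizations ::
    "('s, 'm) rsemimod \<Rightarrow> ('s, 'n) lsemimod \<Rightarrow> ('t, 'y) monoid_scheme \<Rightarrow> ('m \<Rightarrow> 'n \<Rightarrow> 't)
      \<Rightarrow> ('g, 'x) monoid_scheme \<Rightarrow> ('m \<Rightarrow> 'n \<Rightarrow> 'g) \<Rightarrow> ('t \<Rightarrow> 'g) set" where
  "factorizations M N T \<tau> G \<beta> =
    {\<gamma> \<in> monoid_arr T G. \<forall>m \<in> carrier M. \<forall>n \<in> carrier N. \<gamma> (\<tau> m n) = \<beta> m n}"


section \<open>The two tensor products\<close>

definition free_monoid :: "('s, 'm) rsemimod \<Rightarrow> ('s, 'n) lsemimod \<Rightarrow> ('m \<times> 'n) multiset monoid" where
  "free_monoid M N =
    \<lparr> carrier = {f. set_mset f \<subseteq> carrier M \<times> carrier N}, monoid.mult = (+), one = {#} \<rparr>"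

abbreviation delta :: "'m \<Rightarrow> 'n \<Rightarrow> ('m \<times> 'n) multiset" ("\<delta>") where
  "\<delta> m n \<equiv> {#(m, n)#}"

inductive_set balance_gens ::
    "('s, 'z) ring_scheme \<Rightarrow> ('s, 'm) rsemimod \<Rightarrow> ('s, 'n) lsemimod
      \<Rightarrow> (('m \<times> 'n) multiset \<times> ('m \<times> 'n) multiset) set"
  for S :: "('s, 'z) ring_scheme" and M :: "('s, 'm) rsemimod" and N :: "('s, 'n) lsemimod" where
  add_left: "\<lbrakk>m\<^sub>1 \<in> carrier M; m\<^sub>2 \<in> carrier M; n \<in> carrier N\<rbrakk>
    \<Longrightarrow> (\<delta> (m\<^sub>1 \<otimes>\<^bsub>M\<^esub> m\<^sub>2) n, \<delta> m\<^sub>1 n + \<delta> m\<^sub>2 n) \<in> balance_gens S M N"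
| add_right: "\<lbrakk>m \<in> carrier M; n\<^sub>1 \<in> carrier N; n\<^sub>2 \<in> carrier N\<rbrakk>
    \<Longrightarrow> (\<delta> m (n\<^sub>1 \<otimes>\<^bsub>N\<^esub> n\<^sub>2), \<delta> m n\<^sub>1 + \<delta> m n\<^sub>2) \<in> balance_gens S M N"
| balance: "\<lbrakk>m \<in> carrier M; s \<in> carrier S; n \<in> carrier N\<rbrakk>
    \<Longrightarrow> (\<delta> (ract M m s) n, \<delta> m (lact N s n)) \<in> balance_gens S M N"

text \<open>
  \<open>M \<otimes>\<^sub>S N\<close> is the free Abelian monoid modulo the least congruence that makes
  \<open>(m, n) \<mapsto> [\<delta> m n]\<close> balanced.  The relations \<open>zero_left\<close> and \<open>zero_right\<close> are not consequences of
  the others, as nothing can be cancelled here.  The universal property, which determines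
  \<open>M \<otimes>\<^sub>S N\<close>, is \<open>tensor_universal\<close> below.
\<close>

inductive_set tensor_cong ::
    "('s, 'z) ring_scheme \<Rightarrow> ('s, 'm) rsemimod \<Rightarrow> ('s, 'n) lsemimod
      \<Rightarrow> (('m \<times> 'n) multiset \<times> ('m \<times> 'n) multiset) set"
  for S :: "('s, 'z) ring_scheme" and M :: "('s, 'm) rsemimod" and N :: "('s, 'n) lsemimod" where
  gen: "(f, g) \<in> balance_gens S M N \<Longrightarrow> (f, g) \<in> tensor_cong S M N"
| zero_left: "n \<in> carrier N \<Longrightarrow> (\<delta> \<one>\<^bsub>M\<^esub> n, {#}) \<in> tensor_cong S M N"
| zero_right: "m \<in> carrier M \<Longrightarrow> (\<delta> m \<one>\<^bsub>N\<^esub>, {#}) \<in> tensor_cong S M N"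
| refl: "f \<in> carrier (free_monoid M N) \<Longrightarrow> (f, f) \<in> tensor_cong S M N"
| sym: "(f, g) \<in> tensor_cong S M N \<Longrightarrow> (g, f) \<in> tensor_cong S M N"
| trans: "(f, g) \<in> tensor_cong S M N \<Longrightarrow> (g, h) \<in> tensor_cong S M N \<Longrightarrow> (f, h) \<in> tensor_cong S M N"
| add: "(f, g) \<in> tensor_cong S M N \<Longrightarrow> (f', g') \<in> tensor_cong S M N
    \<Longrightarrow> (f + f', g + g') \<in> tensor_cong S M N"

definition tensor ::
    "('s, 'z) ring_scheme \<Rightarrow> ('s, 'm) rsemimod \<Rightarrow> ('s, 'n) lsemimod \<Rightarrow> ('m \<times> 'n) multiset set monoid" where
  "tensor S M N = quotient_monoid (free_monoid M N) (tensor_cong S M N)"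

definition tensor_map ::
    "('s, 'z) ring_scheme \<Rightarrow> ('s, 'm) rsemimod \<Rightarrow> ('s, 'n) lsemimod \<Rightarrow> 'm \<Rightarrow> 'n \<Rightarrow> ('m \<times> 'n) multiset set" where
  "tensor_map S M N m n = tensor_cong S M N `` {\<delta> m n}"

inductive_set takahashi_submonoid ::
    "('s, 'z) ring_scheme \<Rightarrow> ('s, 'm) rsemimod \<Rightarrow> ('s, 'n) lsemimod
      \<Rightarrow> (('m \<times> 'n) multiset \<times> ('m \<times> 'n) multiset) set"
  for S :: "('s, 'z) ring_scheme" and M :: "('s, 'm) rsemimod" and N :: "('s, 'n) lsemimod" where
  zero: "({#}, {#}) \<in> takahashi_submonoid S M N"
| gen: "(f, g) \<in> balance_gens S M N \<Longrightarrow> (f, g) \<in> takahashi_submonoid S M N"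
| gen_swap: "(f, g) \<in> balance_gens S M N \<Longrightarrow> (g, f) \<in> takahashi_submonoid S M N"
| add: "(f, g) \<in> takahashi_submonoid S M N \<Longrightarrow> (f', g') \<in> takahashi_submonoid S M N
    \<Longrightarrow> (f + f', g + g') \<in> takahashi_submonoid S M N"

definition takahashi_cong ::
    "('s, 'z) ring_scheme \<Rightarrow> ('s, 'm) rsemimod \<Rightarrow> ('s, 'n) lsemimod
      \<Rightarrow> (('m \<times> 'n) multiset \<times> ('m \<times> 'n) multiset) set" where
  "takahashi_cong S M N = {(f, g). f \<in> carrier (free_monoid M N) \<and> g \<in> carrier (free_monoid M N) \<and>
     (\<exists>(h, h') \<in> takahashi_submonoid S M N. f + h = g + h')}"

definition takahashi ::
    "('s, 'z) ring_scheme \<Rightarrow> ('s, 'm) rsemimod \<Rightarrow> ('s, 'n) lsemimod \<Rightarrow> ('m \<times> 'n) multiset set monoid" where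
  "takahashi S M N = quotient_monoid (free_monoid M N) (takahashi_cong S M N)"

definition takahashi_map ::
    "('s, 'z) ring_scheme \<Rightarrow> ('s, 'm) rsemimod \<Rightarrow> ('s, 'n) lsemimod \<Rightarrow> 'm \<Rightarrow> 'n \<Rightarrow> ('m \<times> 'n) multiset set" where
  "takahashi_map S M N m n = takahashi_cong S M N `` {\<delta> m n}"

text \<open>On arrows, both functors are given by the unique factorization of \<open>(m, n) \<mapsto> \<tau>' (f m) (g n)\<close>.\<close>

definition tensor_fctr ::
    "('s, 'z) ring_scheme \<Rightarrow>
      (('s, 'm) rsemimod \<times> ('s, 'n) lsemimod, ('m \<Rightarrow> 'm) \<times> ('n \<Rightarrow> 'n),
       ('m \<times> 'n) multiset set monoid, ('m \<times> 'n) multiset set \<Rightarrow> ('m \<times> 'n) multiset set) fctr" where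
  "tensor_fctr S =
    \<lparr> omap = (\<lambda>(M, N). tensor S M N),
      amap = (\<lambda>(M, N) (M', N') (f, g). THE \<gamma>. \<gamma> \<in> factorizations M N
        (tensor S M N) (tensor_map S M N)
        (tensor S M' N') (\<lambda>m n. tensor_map S M' N' (f m) (g n))) \<rparr>"

definition takahashi_fctr ::
    "('s, 'z) ring_scheme \<Rightarrow>
      (('s, 'm) rsemimod \<times> ('s, 'n) lsemimod, ('m \<Rightarrow> 'm) \<times> ('n \<Rightarrow> 'n),
       ('m \<times> 'n) multiset set monoid, ('m \<times> 'n) multiset set \<Rightarrow> ('m \<times> 'n) multiset set) fctr" where
  "takahashi_fctr S =
    \<lparr> omap = (\<lambda>(M, N). takahashi S M N),
      amap = (\<lambda>(M, N) (M', N') (f, g). THE \<gamma>. \<gamma> \<in> factorizations M N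
        (takahashi S M N) (takahashi_map S M N)
        (takahashi S M' N') (\<lambda>m n. takahashi_map S M' N' (f m) (g n))) \<rparr>"


section \<open>Well-definedness and universal properties\<close>

lemma ident_monoid_arr: "(\<lambda>x \<in> carrier A. x) \<in> monoid_arr A A" if "monoid A"
  using that by (auto simp: monoid_arr_def monoid_hom_def hom_def monoid.m_closed monoid.one_closed)

lemma compose_monoid_arr:
  assumes "monoid A" "f \<in> monoid_arr A B" "g \<in> monoid_arr B C"
  shows "compose (carrier A) g f \<in> monoid_arr A C"
  using assms
  by (auto simp: monoid_arr_def monoid_hom_def hom_def compose_def monoid.m_closed monoid.one_closed Pi_iff)

lemma compose_ident_left: "f \<in> monoid_arr A B \<Longrightarrow> compose (carrier A) (\<lambda>x \<in> carrier B. x) f = f"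
  by (rule extensionalityI[of _ "carrier A"]) (auto simp: monoid_arr_def monoid_hom_def hom_def compose_def)

lemma compose_ident_right: "f \<in> monoid_arr A B \<Longrightarrow> compose (carrier A) f (\<lambda>x \<in> carrier A. x) = f"
  by (rule extensionalityI[of _ "carrier A"]) (auto simp: monoid_arr_def monoid_hom_def hom_def compose_def)

lemma compose_monoid_arr_assoc:
  "f \<in> monoid_arr A B \<Longrightarrow>
    compose (carrier A) (compose (carrier B) h g) f = compose (carrier A) h (compose (carrier A) g f)"
  by (auto simp: fun_eq_iff compose_def restrict_def monoid_arr_def monoid_hom_def hom_def Pi_iff)

lemma is_category_AbMon: "is_category AbMon"
  unfolding is_category_def AbMon_def
  by (auto simp: ident_monoid_arr compose_ident_left compose_ident_right
      compose_monoid_arr_assoc compose_monoid_arr comm_monoid_def)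

lemma is_category_CAbMon: "is_category CAbMon"
  unfolding is_category_def CAbMon_def AbMon_def
  by (auto simp: ident_monoid_arr compose_ident_left compose_ident_right
      compose_monoid_arr_assoc compose_monoid_arr comm_monoid_def comm_monoid_cancel_def)

lemma is_category_right_semimodules: "is_category (right_semimodules S)"
proof -
  have *: "right_semimodule S M \<Longrightarrow> monoid M" for M
    unfolding right_semimodule_def comm_monoid_def by simp
  have id: "(\<lambda>x \<in> carrier M. x) \<in> rlinear_arr S M M" if "right_semimodule S M" for M
    using that by (auto simp: rlinear_arr_def ident_monoid_arr * right_semimodule.ract_closed)
  have comp: "compose (carrier M) g f \<in> rlinear_arr S M M''"
    if "right_semimodule S M" "f \<in> rlinear_arr S M M'" "g \<in> rlinear_arr S M' M''" for M M' M'' f g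
  proof -
    have "f \<in> carrier M \<rightarrow> carrier M'"
      using that(2) by (auto simp: rlinear_arr_def monoid_arr_def monoid_hom_def hom_def)
    then show ?thesis
      using that
      by (auto simp: rlinear_arr_def intro!: compose_monoid_arr *)
        (auto simp: compose_def Pi_iff right_semimodule.ract_closed)
  qed
  have sub: "f \<in> rlinear_arr S M M' \<Longrightarrow> f \<in> monoid_arr M M'" for f M M'
    by (simp add: rlinear_arr_def)
  show ?thesis
    unfolding is_category_def right_semimodules_def
    by (auto intro: id comp compose_ident_left[OF sub] compose_ident_right[OF sub]
        compose_monoid_arr_assoc[OF sub])
qed

lemma is_category_left_semimodules: "is_category (left_semimodules S)"
proof -
  have *: "left_semimodule S M \<Longrightarrow> monoid M" for M
    unfolding left_semimodule_def comm_monoid_def by simp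
  have id: "(\<lambda>x \<in> carrier M. x) \<in> llinear_arr S M M" if "left_semimodule S M" for M
    using that by (auto simp: llinear_arr_def ident_monoid_arr * left_semimodule.lact_closed)
  have comp: "compose (carrier M) g f \<in> llinear_arr S M M''"
    if "left_semimodule S M" "f \<in> llinear_arr S M M'" "g \<in> llinear_arr S M' M''" for M M' M'' f g
  proof -
    have "f \<in> carrier M \<rightarrow> carrier M'"
      using that(2) by (auto simp: llinear_arr_def monoid_arr_def monoid_hom_def hom_def)
    then show ?thesis
      using that
      by (auto simp: llinear_arr_def intro!: compose_monoid_arr *)
        (auto simp: compose_def Pi_iff left_semimodule.lact_closed)
  qed
  have sub: "f \<in> llinear_arr S M M' \<Longrightarrow> f \<in> monoid_arr M M'" for f M M'
    by (simp add: llinear_arr_def)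
  show ?thesis
    unfolding is_category_def left_semimodules_def
    by (auto intro: id comp compose_ident_left[OF sub] compose_ident_right[OF sub]
        compose_monoid_arr_assoc[OF sub])
qed

lemma is_category_prod_cat: "is_category C \<Longrightarrow> is_category D \<Longrightarrow> is_category (C \<times>\<^sub>C D)"
  unfolding is_category_def prod_cat_def by auto

definition congruence :: "('a, 'x) monoid_scheme \<Rightarrow> ('a \<times> 'a) set \<Rightarrow> bool" where
  "congruence A r \<longleftrightarrow> equiv (carrier A) r \<and>
    (\<forall>(x, x') \<in> r. \<forall>(y, y') \<in> r. (x \<otimes>\<^bsub>A\<^esub> y, x' \<otimes>\<^bsub>A\<^esub> y') \<in> r)"

lemma congruence_equiv: "congruence A r \<Longrightarrow> equiv (carrier A) r"
  by (simp add: congruence_def)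

lemma congruence_mult:
  "congruence A r \<Longrightarrow> (x, x') \<in> r \<Longrightarrow> (y, y') \<in> r \<Longrightarrow> (x \<otimes>\<^bsub>A\<^esub> y, x' \<otimes>\<^bsub>A\<^esub> y') \<in> r"
  by (auto simp: congruence_def)

context
  fixes A :: "('a, 'x) monoid_scheme" and r
  assumes A: "comm_monoid A" and r: "congruence A r"
begin

interpretation comm_monoid A by (rule A)

lemmas cong_equiv = congruence_equiv[OF r] and cong_mult = congruence_mult[OF r]

lemma quotient_mult:
  assumes "x \<in> carrier A" "y \<in> carrier A"
  shows "r `` {x} \<otimes>\<^bsub>quotient_monoid A r\<^esub> r `` {y} = r `` {x \<otimes>\<^bsub>A\<^esub> y}"
proof -
  have "r `` {x' \<otimes>\<^bsub>A\<^esub> y'} = r `` {x \<otimes>\<^bsub>A\<^esub> y}" if "(x, x') \<in> r" "(y, y') \<in> r" for x' y'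
    using equiv_class_eq[OF cong_equiv cong_mult[OF that]] by simp
  moreover have "(x, x) \<in> r" "(y, y) \<in> r"
    using assms cong_equiv by (auto simp: equiv_def refl_on_def)
  ultimately have "(\<Union>x' \<in> r `` {x}. \<Union>y' \<in> r `` {y}. r `` {x' \<otimes>\<^bsub>A\<^esub> y'}) = r `` {x \<otimes>\<^bsub>A\<^esub> y}"
    by blast
  then show ?thesis by (simp add: quotient_monoid_def)
qed

lemma quotient_carrierE:
  assumes "X \<in> carrier (quotient_monoid A r)"
  obtains x where "x \<in> carrier A" "X = r `` {x}"
  using assms by (auto simp: quotient_monoid_def elim: quotientE)

lemma quotient_carrierI: "x \<in> carrier A \<Longrightarrow> r `` {x} \<in> carrier (quotient_monoid A r)"
  by (auto simp: quotient_monoid_def quotientI)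

lemma quotient_one: "\<one>\<^bsub>quotient_monoid A r\<^esub> = r `` {\<one>\<^bsub>A\<^esub>}"
  by (simp add: quotient_monoid_def)

lemma comm_monoid_quotient: "comm_monoid (quotient_monoid A r)"
proof (rule comm_monoidI)
  fix X Y Z
  assume "X \<in> carrier (quotient_monoid A r)" "Y \<in> carrier (quotient_monoid A r)"
    "Z \<in> carrier (quotient_monoid A r)"
  then show "X \<otimes>\<^bsub>quotient_monoid A r\<^esub> Y \<otimes>\<^bsub>quotient_monoid A r\<^esub> Z
      = X \<otimes>\<^bsub>quotient_monoid A r\<^esub> (Y \<otimes>\<^bsub>quotient_monoid A r\<^esub> Z)"
    by (elim quotient_carrierE) (simp add: quotient_mult m_assoc)
next
  fix X Y
  assume XY: "X \<in> carrier (quotient_monoid A r)" "Y \<in> carrier (quotient_monoid A r)"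
  then show "X \<otimes>\<^bsub>quotient_monoid A r\<^esub> Y \<in> carrier (quotient_monoid A r)"
    by (elim quotient_carrierE) (simp add: quotient_mult quotient_carrierI)
  from XY show "X \<otimes>\<^bsub>quotient_monoid A r\<^esub> Y = Y \<otimes>\<^bsub>quotient_monoid A r\<^esub> X"
    by (elim quotient_carrierE) (simp add: quotient_mult m_comm)
next
  fix X assume "X \<in> carrier (quotient_monoid A r)"
  then show "\<one>\<^bsub>quotient_monoid A r\<^esub> \<otimes>\<^bsub>quotient_monoid A r\<^esub> X = X"
    by (elim quotient_carrierE) (simp add: quotient_mult quotient_one)
qed (simp add: quotient_one quotient_carrierI)

lemma quotient_factor:
  assumes h: "h \<in> monoid_hom A B" and resp: "\<And>x y. (x, y) \<in> r \<Longrightarrow> h x = h y"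
  shows "\<exists>\<gamma> \<in> monoid_arr (quotient_monoid A r) B. \<forall>x \<in> carrier A. \<gamma> (r `` {x}) = h x"
proof -
  define \<gamma> where "\<gamma> = (\<lambda>X \<in> carrier (quotient_monoid A r). h (SOME x. x \<in> X))"
  have \<gamma>: "\<gamma> (r `` {x}) = h x" if "x \<in> carrier A" for x
  proof -
    have "x \<in> r `` {x}" using that cong_equiv by (auto simp: equiv_def refl_on_def)
    then have "(SOME y. y \<in> r `` {x}) \<in> r `` {x}" by (rule someI)
    then have "h x = h (SOME y. y \<in> r `` {x})" by (intro resp) simp
    then show ?thesis using that by (simp add: \<gamma>_def quotient_carrierI)
  qed
  moreover have "\<gamma> \<in> monoid_arr (quotient_monoid A r) B"
  proof -
    have "\<gamma> X \<in> carrier B" if "X \<in> carrier (quotient_monoid A r)" for X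
      using that h by (elim quotient_carrierE) (auto simp: \<gamma> monoid_hom_def hom_def)
    moreover have "\<gamma> (X \<otimes>\<^bsub>quotient_monoid A r\<^esub> Y) = \<gamma> X \<otimes>\<^bsub>B\<^esub> \<gamma> Y"
      if "X \<in> carrier (quotient_monoid A r)" "Y \<in> carrier (quotient_monoid A r)" for X Y
      using that h by (elim quotient_carrierE) (simp add: \<gamma> quotient_mult monoid_hom_def hom_def)
    moreover have "\<gamma> \<in> extensional (carrier (quotient_monoid A r))" by (simp add: \<gamma>_def)
    ultimately show ?thesis
      using h by (auto simp: monoid_arr_def monoid_hom_def hom_def \<gamma> quotient_one)
  qed
  ultimately show ?thesis by blast
qed

end

lemma comm_monoid_free: "comm_monoid (free_monoid M N)"
  by (rule comm_monoidI) (auto simp: free_monoid_def)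

lemma free_factor:
  fixes M :: "('s, 'm) rsemimod" and N :: "('s, 'n) lsemimod"
  assumes G: "comm_monoid G" and \<beta>: "\<And>m n. m \<in> carrier M \<Longrightarrow> n \<in> carrier N \<Longrightarrow> \<beta> m n \<in> carrier G"
  shows "\<exists>h \<in> monoid_hom (free_monoid M N) G. \<forall>m \<in> carrier M. \<forall>n \<in> carrier N. h (\<delta> m n) = \<beta> m n"
proof -
  interpret G: comm_monoid G by (rule G)
  let ?b = "\<lambda>f p. case_prod \<beta> p [^]\<^bsub>G\<^esub> count f p"
  define h where "h f = finprod G (?b f) (set_mset f)" for f :: "('m \<times> 'n) multiset"
  have \<beta>': "case_prod \<beta> p \<in> carrier G" if "p \<in> carrier M \<times> carrier N" for p
    using that \<beta> by auto
  have h: "h f = finprod G (?b f) P"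
    if "finite P" "set_mset f \<subseteq> P" "P \<subseteq> carrier M \<times> carrier N" for f P
    unfolding h_def
    by (rule G.finprod_mono_neutral_cong_left)
      (use that in \<open>auto intro!: G.nat_pow_closed \<beta> simp: not_in_iff\<close>)
  have "h f \<in> carrier G" if "set_mset f \<subseteq> carrier M \<times> carrier N" for f
    unfolding h_def using that \<beta>' by (intro G.finprod_closed) auto
  moreover have "h (f + g) = h f \<otimes>\<^bsub>G\<^esub> h g"
    if "set_mset f \<subseteq> carrier M \<times> carrier N" "set_mset g \<subseteq> carrier M \<times> carrier N" for f g
  proof -
    let ?P = "set_mset f \<union> set_mset g"
    have P: "finite ?P" "?P \<subseteq> carrier M \<times> carrier N" using that by auto
    have "h (f + g) = finprod G (?b (f + g)) ?P" by (rule h) (use P in auto)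
    also have "\<dots> = finprod G (\<lambda>p. ?b f p \<otimes>\<^bsub>G\<^esub> ?b g p) ?P"
      by (rule G.finprod_cong') (use P \<beta>' in \<open>auto simp: G.nat_pow_mult subset_iff\<close>)
    also have "\<dots> = finprod G (?b f) ?P \<otimes>\<^bsub>G\<^esub> finprod G (?b g) ?P"
      by (rule G.finprod_multf) (use P \<beta>' in auto)
    also have "\<dots> = h f \<otimes>\<^bsub>G\<^esub> h g" using h[of ?P f] h[of ?P g] P by simp
    finally show ?thesis .
  qed
  moreover have "h {#} = \<one>\<^bsub>G\<^esub>" by (simp add: h_def)
  moreover have "h (\<delta> m n) = \<beta> m n" if "m \<in> carrier M" "n \<in> carrier N" for m n
    using that \<beta> by (simp add: h_def)
  ultimately show ?thesis
    by (intro bexI[of _ h]) (auto simp: monoid_hom_def hom_def free_monoid_def)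
qed

lemma free_hom_eq:
  assumes "h \<in> monoid_hom (free_monoid M N) G" "h' \<in> monoid_hom (free_monoid M N) G"
    and "\<And>m n. m \<in> carrier M \<Longrightarrow> n \<in> carrier N \<Longrightarrow> h (\<delta> m n) = h' (\<delta> m n)"
    and "f \<in> carrier (free_monoid M N)"
  shows "h f = h' f"
  using assms(4)
proof (induction f)
  case empty
  then show ?case using assms(1,2) by (simp add: monoid_hom_def free_monoid_def)
next
  case (add p f)
  obtain m n where p: "p = (m, n)" by force
  have mn: "m \<in> carrier M" "n \<in> carrier N" "f \<in> carrier (free_monoid M N)"
    using add.prems by (auto simp: free_monoid_def p)
  have *: "k (\<delta> m n + f) = k (\<delta> m n) \<otimes>\<^bsub>G\<^esub> k f" if "k \<in> monoid_hom (free_monoid M N) G" for k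
  proof -
    have "k (x + y) = k x \<otimes>\<^bsub>G\<^esub> k y"
      if "x \<in> carrier (free_monoid M N)" "y \<in> carrier (free_monoid M N)" for x y
      using \<open>k \<in> _\<close> that by (simp add: monoid_hom_def hom_def free_monoid_def)
    from this[of "\<delta> m n" f] mn show ?thesis by (simp add: free_monoid_def)
  qed
  show ?case using *[OF assms(1)] *[OF assms(2)] add.IH mn assms(3) by (simp add: p)
qed

lemma free_quotient_universal:
  fixes M :: "('s, 'm) rsemimod" and N :: "('s, 'n) lsemimod"
  assumes G: "comm_monoid G" and r: "congruence (free_monoid M N) r"
    and \<beta>: "\<And>m n. m \<in> carrier M \<Longrightarrow> n \<in> carrier N \<Longrightarrow> \<beta> m n \<in> carrier G"
    and resp: "\<And>h f g. h \<in> monoid_hom (free_monoid M N) G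
      \<Longrightarrow> (\<And>m n. m \<in> carrier M \<Longrightarrow> n \<in> carrier N \<Longrightarrow> h (\<delta> m n) = \<beta> m n)
      \<Longrightarrow> (f, g) \<in> r \<Longrightarrow> h f = h g"
  shows "\<exists>!\<gamma>. \<gamma> \<in> factorizations M N (quotient_monoid (free_monoid M N) r) (\<lambda>m n. r `` {\<delta> m n}) G \<beta>"
proof -
  let ?F = "free_monoid M N" let ?Q = "quotient_monoid ?F r"
  note qm = quotient_mult[OF comm_monoid_free r] and qI = quotient_carrierI[OF comm_monoid_free r]
    and qE = quotient_carrierE[OF comm_monoid_free r]
  have \<delta>: "\<delta> m n \<in> carrier ?F" if "m \<in> carrier M" "n \<in> carrier N" for m n
    using that by (simp add: free_monoid_def)
  interpret F: comm_monoid ?F by (rule comm_monoid_free)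
  obtain h where h: "h \<in> monoid_hom ?F G"
    "\<And>m n. m \<in> carrier M \<Longrightarrow> n \<in> carrier N \<Longrightarrow> h (\<delta> m n) = \<beta> m n"
    using free_factor[of G M N \<beta>, OF G \<beta>] by blast
  obtain \<gamma> where \<gamma>: "\<gamma> \<in> monoid_arr ?Q G" "\<And>x. x \<in> carrier ?F \<Longrightarrow> \<gamma> (r `` {x}) = h x"
    using quotient_factor[OF comm_monoid_free r h(1) resp[OF h]] by auto
  show ?thesis
  proof (rule ex1I[of _ \<gamma>])
    show "\<gamma> \<in> factorizations M N ?Q (\<lambda>m n. r `` {\<delta> m n}) G \<beta>"
      using \<gamma> h(2) \<delta> by (simp add: factorizations_def)
    fix \<gamma>' assume \<gamma>': "\<gamma>' \<in> factorizations M N ?Q (\<lambda>m n. r `` {\<delta> m n}) G \<beta>"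
    have h': "(\<lambda>x. \<gamma>' (r `` {x})) \<in> monoid_hom ?F G"
      using \<gamma>' by (auto simp: factorizations_def monoid_arr_def monoid_hom_def hom_def
          qI qm[symmetric] quotient_one[OF comm_monoid_free r])
    have "\<gamma>' (r `` {x}) = \<gamma> (r `` {x})" if "x \<in> carrier ?F" for x
      using free_hom_eq[OF h' h(1) _ that] \<gamma>' h(2) \<gamma>(2)[OF that] by (simp add: factorizations_def)
    then show "\<gamma>' = \<gamma>"
      using \<gamma>' \<gamma>(1)
      by (intro extensionalityI[of _ "carrier ?Q"])
        (auto simp: factorizations_def monoid_arr_def elim!: qE)
  qed
qed

lemma tensor_cong_congruence:
  assumes M: "right_semimodule S M" and N: "left_semimodule S N"
  shows "congruence (free_monoid M N) (tensor_cong S M N)"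
proof -
  interpret M: right_semimodule S M by (rule M)
  interpret N: left_semimodule S N by (rule N)
  have "f \<in> carrier (free_monoid M N) \<and> g \<in> carrier (free_monoid M N)"
    if "(f, g) \<in> tensor_cong S M N" for f g
    using that
    by induction (auto simp: free_monoid_def M.ract_closed N.lact_closed elim!: balance_gens.cases)
  then have "equiv (carrier (free_monoid M N)) (tensor_cong S M N)"
    by (intro equivI) (auto intro!: refl_onI symI transI intro: tensor_cong.refl tensor_cong.sym tensor_cong.trans)
  then show ?thesis
    by (auto simp: congruence_def free_monoid_def intro: tensor_cong.add)
qed

lemma balance_gens_free:
  assumes M: "right_semimodule S M" and N: "left_semimodule S N"
    and "(f, g) \<in> balance_gens S M N"
  shows "f \<in> carrier (free_monoid M N)" "g \<in> carrier (free_monoid M N)"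
proof -
  interpret M: right_semimodule S M by (rule M)
  interpret N: left_semimodule S N by (rule N)
  show "f \<in> carrier (free_monoid M N)" "g \<in> carrier (free_monoid M N)"
    using assms(3) by (auto simp: free_monoid_def M.ract_closed N.lact_closed elim!: balance_gens.cases)
qed

lemma balance_gens_resp:
  assumes M: "right_semimodule S M" and N: "left_semimodule S N"
    and \<beta>: "balanced S M N G \<beta>" and h: "h \<in> monoid_hom (free_monoid M N) G"
    and h\<delta>: "\<And>m n. m \<in> carrier M \<Longrightarrow> n \<in> carrier N \<Longrightarrow> h (\<delta> m n) = \<beta> m n"
    and fg: "(f, g) \<in> balance_gens S M N"
  shows "h f = h g"
proof -
  interpret M: right_semimodule S M by (rule M)
  interpret N: left_semimodule S N by (rule N)
  have mult: "h (\<delta> m n + \<delta> m' n') = h (\<delta> m n) \<otimes>\<^bsub>G\<^esub> h (\<delta> m' n')"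
    if "m \<in> carrier M" "n \<in> carrier N" "m' \<in> carrier M" "n' \<in> carrier N" for m n m' n'
  proof -
    have "h (x + y) = h x \<otimes>\<^bsub>G\<^esub> h y"
      if "x \<in> carrier (free_monoid M N)" "y \<in> carrier (free_monoid M N)" for x y
      using h that by (simp add: monoid_hom_def hom_def free_monoid_def)
    from this[of "\<delta> m n" "\<delta> m' n'"] that show ?thesis by (simp add: free_monoid_def)
  qed
  from fg show ?thesis
  proof cases
    case (add_left m\<^sub>1 m\<^sub>2 n)
    then show ?thesis
      using \<beta> mult[of m\<^sub>1 n m\<^sub>2 n] by (simp add: h\<delta> balanced_def monoid_hom_def hom_def)
  next
    case (add_right m n\<^sub>1 n\<^sub>2)
    then show ?thesis
      using \<beta> mult[of m n\<^sub>1 m n\<^sub>2] by (simp add: h\<delta> balanced_def monoid_hom_def hom_def)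
  next
    case (balance m s n)
    then show ?thesis
      using \<beta> by (simp add: h\<delta> balanced_def M.ract_closed N.lact_closed)
  qed
qed

lemma balanced_closed:
  "balanced S M N G \<beta> \<Longrightarrow> m \<in> carrier M \<Longrightarrow> n \<in> carrier N \<Longrightarrow> \<beta> m n \<in> carrier G"
  by (auto simp: balanced_def monoid_hom_def hom_def)

lemma balanced_quotient:
  fixes S :: "('s, 'z) ring_scheme" and M :: "('s, 'm) rsemimod" and N :: "('s, 'n) lsemimod"
  assumes M: "right_semimodule S M" and N: "left_semimodule S N"
    and r: "congruence (free_monoid M N) r"
    and gens: "\<And>f g. (f, g) \<in> balance_gens S M N \<Longrightarrow> (f, g) \<in> r"
    and zl: "\<And>n. n \<in> carrier N \<Longrightarrow> (\<delta> \<one>\<^bsub>M\<^esub> n, {#}) \<in> r"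
    and zr: "\<And>m. m \<in> carrier M \<Longrightarrow> (\<delta> m \<one>\<^bsub>N\<^esub>, {#}) \<in> r"
  shows "balanced S M N (quotient_monoid (free_monoid M N) r) (\<lambda>m n. r `` {\<delta> m n})"
proof -
  interpret M: right_semimodule S M by (rule M)
  interpret N: left_semimodule S N by (rule N)
  let ?F = "free_monoid M N" let ?Q = "quotient_monoid ?F r"
  have cls: "r `` {\<delta> m n} \<in> carrier ?Q" if "m \<in> carrier M" "n \<in> carrier N" for m n
    using that by (intro quotient_carrierI[OF comm_monoid_free r]) (simp add: free_monoid_def)
  have mult: "r `` {\<delta> m n} \<otimes>\<^bsub>?Q\<^esub> r `` {\<delta> m' n'} = r `` {\<delta> m n + \<delta> m' n'}"
    if "m \<in> carrier M" "n \<in> carrier N" "m' \<in> carrier M" "n' \<in> carrier N" for m n m' n'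
    using quotient_mult[OF comm_monoid_free r, of "\<delta> m n" "\<delta> m' n'"] that
    by (simp add: free_monoid_def)
  have eq: "(f, g) \<in> r \<Longrightarrow> r `` {f} = r `` {g}" for f g
    by (rule equiv_class_eq[OF congruence_equiv[OF r]])
  have one: "\<one>\<^bsub>?Q\<^esub> = r `` {{#}}"
    using quotient_one[OF comm_monoid_free r] by (simp add: free_monoid_def)
  show ?thesis
    unfolding balanced_def monoid_hom_def hom_def
  proof (intro conjI ballI CollectI)
    fix n x y assume "n \<in> carrier N" "x \<in> carrier M" "y \<in> carrier M"
    then show "r `` {\<delta> (x \<otimes>\<^bsub>M\<^esub> y) n} = r `` {\<delta> x n} \<otimes>\<^bsub>?Q\<^esub> r `` {\<delta> y n}"
      unfolding mult[OF \<open>x \<in> _\<close> \<open>n \<in> _\<close> \<open>y \<in> _\<close> \<open>n \<in> _\<close>]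
      by (intro eq gens balance_gens.add_left)
  next
    fix m x y assume "m \<in> carrier M" "x \<in> carrier N" "y \<in> carrier N"
    then show "r `` {\<delta> m (x \<otimes>\<^bsub>N\<^esub> y)} = r `` {\<delta> m x} \<otimes>\<^bsub>?Q\<^esub> r `` {\<delta> m y}"
      unfolding mult[OF \<open>m \<in> _\<close> \<open>x \<in> _\<close> \<open>m \<in> _\<close> \<open>y \<in> _\<close>]
      by (intro eq gens balance_gens.add_right)
  next
    fix m s n assume "m \<in> carrier M" "s \<in> carrier S" "n \<in> carrier N"
    then show "r `` {\<delta> (ract M m s) n} = r `` {\<delta> m (lact N s n)}"
      by (intro eq gens balance_gens.balance)
  qed (auto intro: cls simp del: Image_singleton_iff simp: one eq[OF zl] eq[OF zr])
qed

theorem tensor_universal: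
  assumes M: "right_semimodule S M" and N: "left_semimodule S N"
  shows "comm_monoid (tensor S M N)"
    and "balanced S M N (tensor S M N) (tensor_map S M N)"
    and "\<And>(G :: ('g, 'x) monoid_scheme) \<beta>. comm_monoid G \<Longrightarrow> balanced S M N G \<beta> \<Longrightarrow>
      \<exists>!\<gamma>. \<gamma> \<in> factorizations M N (tensor S M N) (tensor_map S M N) G \<beta>"
proof -
  interpret M: right_semimodule S M by (rule M)
  interpret N: left_semimodule S N by (rule N)
  let ?F = "free_monoid M N" let ?r = "tensor_cong S M N"
  note r = tensor_cong_congruence[OF M N]
  note qm = quotient_mult[OF comm_monoid_free r] and qI = quotient_carrierI[OF comm_monoid_free r]
    and q1 = quotient_one[OF comm_monoid_free r]
  show "comm_monoid (tensor S M N)"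
    unfolding tensor_def by (rule comm_monoid_quotient[OF comm_monoid_free r])
  have \<delta>: "\<delta> m n \<in> carrier ?F" if "m \<in> carrier M" "n \<in> carrier N" for m n
    using that by (simp add: free_monoid_def)
  have eq: "(f, g) \<in> ?r \<Longrightarrow> ?r `` {f} = ?r `` {g}" for f g
    by (rule equiv_class_eq[OF congruence_equiv[OF r]])
  have F: "x \<otimes>\<^bsub>?F\<^esub> y = x + y" "\<one>\<^bsub>?F\<^esub> = {#}" for x y by (simp_all add: free_monoid_def)
  show "balanced S M N (tensor S M N) (tensor_map S M N)"
    unfolding tensor_def tensor_map_def
    by (rule balanced_quotient[OF M N r]) (auto intro: tensor_cong.intros)
  fix G :: "('g, 'x) monoid_scheme" and \<beta>
  assume G: "comm_monoid G" and \<beta>: "balanced S M N G \<beta>"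
  have "h f = h g"
    if h: "h \<in> monoid_hom ?F G" "\<And>m n. m \<in> carrier M \<Longrightarrow> n \<in> carrier N \<Longrightarrow> h (\<delta> m n) = \<beta> m n"
      and fg: "(f, g) \<in> ?r" for h f g
    using fg
  proof induction
    case (gen f g)
    then show ?case using balance_gens_resp[OF M N \<beta> h(1)] h(2) by blast
  next
    case (add f g f' g')
    have "{f, g, f', g'} \<subseteq> carrier ?F"
      using add.hyps congruence_equiv[OF r] by (auto simp: equiv_def)
    then show ?case
      using add.IH h(1) by (simp add: monoid_hom_def hom_def F)
  next
    case (zero_left n)
    then show ?case using h \<beta> by (simp add: monoid_hom_def balanced_def F)
  next
    case (zero_right m)
    then show ?case using h \<beta> by (simp add: monoid_hom_def balanced_def F)
  qed simp_all
  from free_quotient_universal[OF G r balanced_closed[OF \<beta>] this]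
  show "\<exists>!\<gamma>. \<gamma> \<in> factorizations M N (tensor S M N) (tensor_map S M N) G \<beta>"
    unfolding tensor_def tensor_map_def .
qed

lemma takahashi_submonoid_free:
  assumes M: "right_semimodule S M" and N: "left_semimodule S N"
    and "(f, g) \<in> takahashi_submonoid S M N"
  shows "f \<in> carrier (free_monoid M N) \<and> g \<in> carrier (free_monoid M N)"
  using assms(3)
proof induction
  case (gen f g)
  then show ?case using balance_gens_free[OF M N] by blast
next
  case (gen_swap f g)
  then show ?case using balance_gens_free[OF M N] by blast
qed (simp_all add: free_monoid_def)

lemma takahashi_submonoid_sym:
  "(f, g) \<in> takahashi_submonoid S M N \<Longrightarrow> (g, f) \<in> takahashi_submonoid S M N"
  by (induction rule: takahashi_submonoid.induct)
    (blast intro: takahashi_submonoid.intros)+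

lemma takahashi_congI:
  "f \<in> carrier (free_monoid M N) \<Longrightarrow> g \<in> carrier (free_monoid M N) \<Longrightarrow>
    (h, h') \<in> takahashi_submonoid S M N \<Longrightarrow> f + h = g + h' \<Longrightarrow> (f, g) \<in> takahashi_cong S M N"
  by (auto simp: takahashi_cong_def)

lemma takahashi_cong_congruence: "congruence (free_monoid M N) (takahashi_cong S M N)"
proof -
  have "equiv (carrier (free_monoid M N)) (takahashi_cong S M N)"
  proof (intro equivI refl_onI symI transI)
    show "takahashi_cong S M N \<subseteq> carrier (free_monoid M N) \<times> carrier (free_monoid M N)"
      by (auto simp: takahashi_cong_def)
  next
    fix f assume "f \<in> carrier (free_monoid M N)"
    then show "(f, f) \<in> takahashi_cong S M N"
      using takahashi_congI[OF _ _ takahashi_submonoid.zero] by blast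
  next
    fix f g assume "(f, g) \<in> takahashi_cong S M N"
    then show "(g, f) \<in> takahashi_cong S M N"
      by (auto simp: takahashi_cong_def intro!: bexI[OF _ takahashi_submonoid_sym])
  next
    fix f g e assume "(f, g) \<in> takahashi_cong S M N" "(g, e) \<in> takahashi_cong S M N"
    then obtain h h' k k' where *: "(h, h') \<in> takahashi_submonoid S M N" "f + h = g + h'"
      "(k, k') \<in> takahashi_submonoid S M N" "g + k = e + k'"
      "f \<in> carrier (free_monoid M N)" "e \<in> carrier (free_monoid M N)"
      by (auto simp: takahashi_cong_def)
    have "f + (h + k) = (f + h) + k" by (simp only: add.assoc)
    also have "\<dots> = (g + k) + h'" unfolding *(2) by (simp only: ac_simps)
    also have "\<dots> = e + (h' + k')" unfolding *(4) by (simp only: ac_simps)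
    finally have "f + (h + k) = e + (h' + k')" .
    then show "(f, e) \<in> takahashi_cong S M N"
      using * takahashi_submonoid.add[OF *(1) *(3)] by (blast intro: takahashi_congI)
  qed
  moreover have "(f + f', g + g') \<in> takahashi_cong S M N"
    if "(f, g) \<in> takahashi_cong S M N" "(f', g') \<in> takahashi_cong S M N" for f g f' g'
  proof -
    from that obtain h h' k k' where *: "(h, h') \<in> takahashi_submonoid S M N" "f + h = g + h'"
      "(k, k') \<in> takahashi_submonoid S M N" "f' + k = g' + k'"
      "f + f' \<in> carrier (free_monoid M N)" "g + g' \<in> carrier (free_monoid M N)"
      by (auto simp: takahashi_cong_def free_monoid_def)
    have "f + f' + (h + k) = (f + h) + (f' + k)" by (simp only: ac_simps)
    also have "\<dots> = g + g' + (h' + k')" unfolding *(2,4) by (simp only: ac_simps)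
    finally have "f + f' + (h + k) = g + g' + (h' + k')" .
    then show ?thesis
      using * takahashi_submonoid.add[OF *(1) *(3)] by (blast intro: takahashi_congI)
  qed
  ultimately show ?thesis by (auto simp: congruence_def free_monoid_def)
qed

theorem takahashi_universal:
  assumes M: "right_semimodule S M" and N: "left_semimodule S N"
  shows "comm_monoid_cancel (takahashi S M N)"
    and "balanced S M N (takahashi S M N) (takahashi_map S M N)"
    and "\<And>(G :: ('g, 'x) monoid_scheme) \<beta>. comm_monoid_cancel G \<Longrightarrow> balanced S M N G \<beta> \<Longrightarrow>
      \<exists>!\<gamma>. \<gamma> \<in> factorizations M N (takahashi S M N) (takahashi_map S M N) G \<beta>"
proof -
  interpret M: right_semimodule S M by (rule M)
  interpret N: left_semimodule S N by (rule N)
  let ?F = "free_monoid M N" let ?r = "takahashi_cong S M N"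
  note r = takahashi_cong_congruence[of M N S]
  note qm = quotient_mult[OF comm_monoid_free r] and qI = quotient_carrierI[OF comm_monoid_free r]
    and q1 = quotient_one[OF comm_monoid_free r] and qE = quotient_carrierE[OF comm_monoid_free r]
  have \<delta>: "\<delta> m n \<in> carrier ?F" if "m \<in> carrier M" "n \<in> carrier N" for m n
    using that by (simp add: free_monoid_def)
  have eq: "(f, g) \<in> ?r \<Longrightarrow> ?r `` {f} = ?r `` {g}" for f g
    by (rule equiv_class_eq[OF congruence_equiv[OF r]])
  have F: "x \<otimes>\<^bsub>?F\<^esub> y = x + y" "\<one>\<^bsub>?F\<^esub> = {#}" for x y by (simp_all add: free_monoid_def)
  have Fadd: "x \<in> carrier ?F \<Longrightarrow> y \<in> carrier ?F \<Longrightarrow> x + y \<in> carrier ?F" for x y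
    by (simp add: free_monoid_def)
  interpret Q: comm_monoid "takahashi S M N"
    unfolding takahashi_def by (rule comm_monoid_quotient[OF comm_monoid_free r])
  have canc: "(a, b) \<in> ?r" if "(a + c, b + c) \<in> ?r" "a \<in> carrier ?F" "b \<in> carrier ?F" for a b c
  proof -
    from that(1) obtain h h' where *: "(h, h') \<in> takahashi_submonoid S M N" "a + c + h = b + c + h'"
      by (auto simp: takahashi_cong_def)
    have "c + (a + h) = (a + c) + h" by (simp only: ac_simps)
    also have "\<dots> = c + (b + h')" unfolding *(2) by (simp only: ac_simps)
    finally have "a + h = b + h'" by (simp only: add_left_cancel)
    then show ?thesis using that * by (blast intro: takahashi_congI)
  qed
  show "comm_monoid_cancel (takahashi S M N)"
  proof (rule comm_monoid_cancelI)
    show "comm_monoid (takahashi S M N)" ..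
    fix X Y Z
    assume XYZ: "X \<otimes>\<^bsub>takahashi S M N\<^esub> Z = Y \<otimes>\<^bsub>takahashi S M N\<^esub> Z" "X \<in> carrier (takahashi S M N)"
      "Y \<in> carrier (takahashi S M N)" "Z \<in> carrier (takahashi S M N)"
    obtain a b c where abc: "a \<in> carrier ?F" "b \<in> carrier ?F" "c \<in> carrier ?F"
      "X = ?r `` {a}" "Y = ?r `` {b}" "Z = ?r `` {c}"
      using XYZ(2-4) unfolding takahashi_def by (elim qE) blast
    then have "?r `` {a + c} = ?r `` {b + c}"
      using XYZ(1) by (simp add: takahashi_def qm F)
    then have "(a + c, b + c) \<in> ?r"
      using eq_equiv_class[OF _ congruence_equiv[OF r]] Fadd[of b c] abc by blast
    then show "X = Y" using canc abc eq by blast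
  qed
  have gen: "(f, g) \<in> balance_gens S M N \<Longrightarrow> (f, g) \<in> ?r" for f g
    using balance_gens_free[OF M N]
    by (intro takahashi_congI[OF _ _ takahashi_submonoid.gen_swap]) (auto simp: add.commute)
  have zl: "(\<delta> \<one>\<^bsub>M\<^esub> n, {#}) \<in> ?r" if "n \<in> carrier N" for n
  proof (rule canc)
    show "(\<delta> \<one>\<^bsub>M\<^esub> n + \<delta> \<one>\<^bsub>M\<^esub> n, {#} + \<delta> \<one>\<^bsub>M\<^esub> n) \<in> ?r"
      using balance_gens.add_left[of "\<one>\<^bsub>M\<^esub>" M "\<one>\<^bsub>M\<^esub>" n N S] gen congruence_equiv[OF r] that
      by (simp add: equiv_def sym_def)
  qed (use that in \<open>auto simp: free_monoid_def\<close>)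
  have zr: "(\<delta> m \<one>\<^bsub>N\<^esub>, {#}) \<in> ?r" if "m \<in> carrier M" for m
  proof (rule canc)
    show "(\<delta> m \<one>\<^bsub>N\<^esub> + \<delta> m \<one>\<^bsub>N\<^esub>, {#} + \<delta> m \<one>\<^bsub>N\<^esub>) \<in> ?r"
      using balance_gens.add_right[of m M "\<one>\<^bsub>N\<^esub>" N "\<one>\<^bsub>N\<^esub>" S] gen congruence_equiv[OF r] that
      by (simp add: equiv_def sym_def)
  qed (use that in \<open>auto simp: free_monoid_def\<close>)
  show "balanced S M N (takahashi S M N) (takahashi_map S M N)"
    unfolding takahashi_def takahashi_map_def
    by (rule balanced_quotient[OF M N r gen zl zr])
  fix G :: "('g, 'x) monoid_scheme" and \<beta>
  assume G: "comm_monoid_cancel G" and \<beta>: "balanced S M N G \<beta>"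
  interpret G: comm_monoid_cancel G by (rule G)
  have "h f = h g"
    if h: "h \<in> monoid_hom ?F G" "\<And>m n. m \<in> carrier M \<Longrightarrow> n \<in> carrier N \<Longrightarrow> h (\<delta> m n) = \<beta> m n"
      and fg: "(f, g) \<in> ?r" for h f g
  proof -
    have hm: "h (x + y) = h x \<otimes>\<^bsub>G\<^esub> h y" "h x \<in> carrier G"
      if "x \<in> carrier ?F" "y \<in> carrier ?F" for x y
      using h(1) that by (auto simp: monoid_hom_def hom_def F)
    have sub: "h k = h k'" if "(k, k') \<in> takahashi_submonoid S M N" for k k'
      using that
    proof induction
      case (gen f g)
      then show ?case using balance_gens_resp[OF M N \<beta> h(1)] h(2) by blast
    next
      case (gen_swap f g)
      then show ?case using balance_gens_resp[OF M N \<beta> h(1)] h(2) by metis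
    next
      case (add f g f' g')
      then show ?case
        using takahashi_submonoid_free[OF M N add.hyps(1)] takahashi_submonoid_free[OF M N add.hyps(2)]
        by (simp add: hm)
    qed simp
    from fg obtain k k' where k: "(k, k') \<in> takahashi_submonoid S M N" "f + k = g + k'"
      "f \<in> carrier ?F" "g \<in> carrier ?F"
      by (auto simp: takahashi_cong_def)
    have "h f \<otimes>\<^bsub>G\<^esub> h k = h g \<otimes>\<^bsub>G\<^esub> h k"
      using k takahashi_submonoid_free[OF M N k(1)] hm(1)[of f k] hm(1)[of g k'] sub[OF k(1)] by simp
    then show ?thesis
      using G.r_cancel k takahashi_submonoid_free[OF M N k(1)] hm(2) by blast
  qed
  from free_quotient_universal[OF G.comm_monoid_axioms r balanced_closed[OF \<beta>] this]
  show "\<exists>!\<gamma>. \<gamma> \<in> factorizations M N (takahashi S M N) (takahashi_map S M N) G \<beta>"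
    unfolding takahashi_def takahashi_map_def .
qed

end

theory Submission
  imports Defs
begin

text \<open>
  Both \<open>M \<boxtimes>\<^sub>S N\<close> and \<open>\<cc>(M \<otimes>\<^sub>S N)\<close> are universal for balanced maps into cancellative Abelian
  monoids: the former by construction, the latter because a balanced map factors through
  \<open>M \<otimes>\<^sub>S N\<close> and every homomorphism into a cancellative monoid factors through \<open>\<cc>\<close>.  Hence they are
  isomorphic, and functoriality and naturality reduce to the uniqueness of factorizations.
\<close>

section \<open>The cancellative reflection\<close>

lemma monoid_homD:
  assumes "h \<in> monoid_hom A B"
  shows "x \<in> carrier A \<Longrightarrow> h x \<in> carrier B"
    and "x \<in> carrier A \<Longrightarrow> y \<in> carrier A \<Longrightarrow> h (x \<otimes>\<^bsub>A\<^esub> y) = h x \<otimes>\<^bsub>B\<^esub> h y"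
    and "h \<one>\<^bsub>A\<^esub> = \<one>\<^bsub>B\<^esub>"
  using assms by (auto simp: monoid_hom_def hom_def)

lemma monoid_arrD: "f \<in> monoid_arr A B \<Longrightarrow> f \<in> monoid_hom A B"
  by (simp add: monoid_arr_def)

lemma monoid_hom_comp:
  "f \<in> monoid_hom A B \<Longrightarrow> g \<in> monoid_hom B C \<Longrightarrow> (\<lambda>x. g (f x)) \<in> monoid_hom A C"
  by (auto simp: monoid_hom_def hom_def Pi_iff)

text \<open>Witnesses multiply. If \<open>a\<close> equalizes \<open>x\<close> and \<open>y\<close>
  while \<open>b\<close> equalizes \<open>y\<close> and \<open>z\<close>, commutativity lets
  \<open>a\<close> and \<open>b\<close> act one after the other, so their product equalizes
  \<open>x\<close> and \<open>z\<close>. The same product is the witness for compatibility with the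
  operation.\<close>

lemma cancel_rel_congruence:
  assumes "comm_monoid A"
  shows "congruence A (cancel_rel A)"
proof -
  interpret comm_monoid A by (rule assms)
  have "equiv (carrier A) (cancel_rel A)"
  proof (intro equivI refl_onI symI transI)
    show "cancel_rel A \<subseteq> carrier A \<times> carrier A" by (auto simp: cancel_rel_def)
    show "(x, x) \<in> cancel_rel A" if "x \<in> carrier A" for x
      using that by (auto simp: cancel_rel_def)
    show "(y, x) \<in> cancel_rel A" if "(x, y) \<in> cancel_rel A" for x y
      using that by (force simp: cancel_rel_def)
    show "(x, z) \<in> cancel_rel A" if xy: "(x, y) \<in> cancel_rel A" and yz: "(y, z) \<in> cancel_rel A" for x y z
    proof -
      obtain a b where *: "x \<in> carrier A" "y \<in> carrier A" "z \<in> carrier A" "a \<in> carrier A"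
        "b \<in> carrier A" "x \<otimes>\<^bsub>A\<^esub> a = y \<otimes>\<^bsub>A\<^esub> a" "y \<otimes>\<^bsub>A\<^esub> b = z \<otimes>\<^bsub>A\<^esub> b"
        using xy yz by (auto simp: cancel_rel_def)
      have "x \<otimes>\<^bsub>A\<^esub> (a \<otimes>\<^bsub>A\<^esub> b) = (y \<otimes>\<^bsub>A\<^esub> a) \<otimes>\<^bsub>A\<^esub> b" using * m_assoc[of x a b] by simp
      also have "\<dots> = (y \<otimes>\<^bsub>A\<^esub> b) \<otimes>\<^bsub>A\<^esub> a" using *(1-5) by (simp add: m_ac)
      also have "\<dots> = z \<otimes>\<^bsub>A\<^esub> (a \<otimes>\<^bsub>A\<^esub> b)" unfolding *(7) using *(1-5) by (simp add: m_ac)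
      finally show ?thesis using * by (auto simp: cancel_rel_def intro!: bexI[of _ "a \<otimes>\<^bsub>A\<^esub> b"])
    qed
  qed
  moreover have "(x \<otimes>\<^bsub>A\<^esub> y, x' \<otimes>\<^bsub>A\<^esub> y') \<in> cancel_rel A"
    if xx: "(x, x') \<in> cancel_rel A" and yy: "(y, y') \<in> cancel_rel A" for x x' y y'
  proof -
    obtain a b where *: "x \<in> carrier A" "x' \<in> carrier A" "y \<in> carrier A" "y' \<in> carrier A"
      "a \<in> carrier A" "b \<in> carrier A" "x \<otimes>\<^bsub>A\<^esub> a = x' \<otimes>\<^bsub>A\<^esub> a" "y \<otimes>\<^bsub>A\<^esub> b = y' \<otimes>\<^bsub>A\<^esub> b"
      using xx yy by (auto simp: cancel_rel_def)
    have "(x \<otimes>\<^bsub>A\<^esub> y) \<otimes>\<^bsub>A\<^esub> (a \<otimes>\<^bsub>A\<^esub> b) = (x \<otimes>\<^bsub>A\<^esub> a) \<otimes>\<^bsub>A\<^esub> (y \<otimes>\<^bsub>A\<^esub> b)" using *(1-6) by (simp add: m_ac)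
    also have "\<dots> = (x' \<otimes>\<^bsub>A\<^esub> y') \<otimes>\<^bsub>A\<^esub> (a \<otimes>\<^bsub>A\<^esub> b)" unfolding *(7,8) using *(1-6) by (simp add: m_ac)
    finally show ?thesis using * by (auto simp: cancel_rel_def intro!: bexI[of _ "a \<otimes>\<^bsub>A\<^esub> b"])
  qed
  ultimately show ?thesis by (auto simp: congruence_def)
qed

lemma cancel_class_eq:
  "comm_monoid A \<Longrightarrow> (x, y) \<in> cancel_rel A \<Longrightarrow> cancel_rel A `` {x} = cancel_rel A `` {y}"
  by (rule equiv_class_eq[OF congruence_equiv[OF cancel_rel_congruence]])

lemma cancel_monoid_carrierE:
  assumes "comm_monoid A" "X \<in> carrier (cancel_monoid A)"
  obtains x where "x \<in> carrier A" "X = cancel_rel A `` {x}"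
  using quotient_carrierE[OF assms(1) cancel_rel_congruence[OF assms(1)]] assms(2)
  unfolding cancel_monoid_def by blast

lemma cancel_class_hom:
  assumes "comm_monoid A"
  shows "(\<lambda>a. cancel_rel A `` {a}) \<in> monoid_hom A (cancel_monoid A)"
proof -
  note r = cancel_rel_congruence[OF assms]
  show ?thesis
    unfolding monoid_hom_def hom_def cancel_monoid_def
    using quotient_mult[OF assms r] quotient_carrierI[OF assms r] quotient_one[OF assms r]
    by auto
qed

text \<open>A factor common to two related products can be moved into the witness: if
  \<open>a\<close> equalizes \<open>x\<close> times \<open>z\<close> and \<open>y\<close> times
  \<open>z\<close>, then \<open>z\<close> times \<open>a\<close> equalizes \<open>x\<close> and
  \<open>y\<close>.\<close>

lemma comm_monoid_cancel_cancel_monoid: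
  assumes A: "comm_monoid A"
  shows "comm_monoid_cancel (cancel_monoid A)"
proof (rule comm_monoid_cancelI)
  interpret comm_monoid A by (rule A)
  note r = cancel_rel_congruence[OF A]
  show "comm_monoid (cancel_monoid A)"
    unfolding cancel_monoid_def by (rule comm_monoid_quotient[OF A r])
  fix X Y Z
  assume XYZ: "X \<otimes>\<^bsub>cancel_monoid A\<^esub> Z = Y \<otimes>\<^bsub>cancel_monoid A\<^esub> Z" "X \<in> carrier (cancel_monoid A)"
    "Y \<in> carrier (cancel_monoid A)" "Z \<in> carrier (cancel_monoid A)"
  obtain x y z where *: "x \<in> carrier A" "X = cancel_rel A `` {x}" "y \<in> carrier A"
    "Y = cancel_rel A `` {y}" "z \<in> carrier A" "Z = cancel_rel A `` {z}"
    using XYZ(2-4) by (elim cancel_monoid_carrierE[OF A]) blast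
  have "cancel_rel A `` {x \<otimes>\<^bsub>A\<^esub> z} = cancel_rel A `` {y \<otimes>\<^bsub>A\<^esub> z}"
    using XYZ(1) * by (simp add: monoid_homD(2)[OF cancel_class_hom[OF A]])
  then have "(x \<otimes>\<^bsub>A\<^esub> z, y \<otimes>\<^bsub>A\<^esub> z) \<in> cancel_rel A"
    using eq_equiv_class[OF _ congruence_equiv[OF r]] * by blast
  then obtain a where "a \<in> carrier A" "x \<otimes>\<^bsub>A\<^esub> z \<otimes>\<^bsub>A\<^esub> a = y \<otimes>\<^bsub>A\<^esub> z \<otimes>\<^bsub>A\<^esub> a"
    by (auto simp: cancel_rel_def)
  then have "(x, y) \<in> cancel_rel A"
    using * by (auto simp: cancel_rel_def m_assoc intro!: bexI[of _ "z \<otimes>\<^bsub>A\<^esub> a"])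
  then show "X = Y" using cancel_class_eq[OF A] * by blast
qed

section \<open>Universal property of c and its action on arrows\<close>

lemma cancel_rel_hom:
  assumes f: "f \<in> monoid_hom A B" and "(x, y) \<in> cancel_rel A"
  shows "(f x, f y) \<in> cancel_rel B"
proof -
  obtain a where *: "x \<in> carrier A" "y \<in> carrier A" "a \<in> carrier A"
    "x \<otimes>\<^bsub>A\<^esub> a = y \<otimes>\<^bsub>A\<^esub> a"
    using assms(2) by (auto simp: cancel_rel_def)
  have "f x \<otimes>\<^bsub>B\<^esub> f a = f y \<otimes>\<^bsub>B\<^esub> f a"
    using * by (simp add: monoid_homD(2)[OF f, symmetric])
  then show ?thesis using * monoid_homD(1)[OF f] by (auto simp: cancel_rel_def)
qed

text \<open>Uniqueness half of the universal property of c: every element of the quotient is a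
  class, and arrows carry no information off the carrier. All identities between arrows out of c(A)
  are checked this way.\<close>

lemma cancel_hom_eqI:
  assumes A: "comm_monoid A"
    and f: "f \<in> monoid_arr (cancel_monoid A) B" and g: "g \<in> monoid_arr (cancel_monoid A) B"
    and eq: "\<And>a. a \<in> carrier A \<Longrightarrow> f (cancel_rel A `` {a}) = g (cancel_rel A `` {a})"
  shows "f = g"
proof (rule extensionalityI[of _ "carrier (cancel_monoid A)"])
  fix X assume "X \<in> carrier (cancel_monoid A)"
  then show "f X = g X" by (rule cancel_monoid_carrierE[OF A]) (simp add: eq)
qed (use f g in \<open>simp_all add: monoid_arr_def\<close>)

text \<open>Existence half of the universal property. A homomorphism carries a witness in
  \<open>A\<close> to a witness in \<open>B\<close>, and there the image of the witness cancels, so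
  \<open>h\<close> is constant on classes.\<close>

lemma cancel_factor:
  assumes A: "comm_monoid A" and B: "comm_monoid_cancel B" and h: "h \<in> monoid_hom A B"
  shows "\<exists>\<gamma> \<in> monoid_arr (cancel_monoid A) B. \<forall>a \<in> carrier A. \<gamma> (cancel_rel A `` {a}) = h a"
proof -
  interpret B: comm_monoid_cancel B by (rule B)
  have "h x = h y" if "(x, y) \<in> cancel_rel A" for x y
    using cancel_rel_hom[OF h that] B.r_cancel by (fastforce simp: cancel_rel_def)
  from quotient_factor[OF A cancel_rel_congruence[OF A] h this]
  show ?thesis unfolding cancel_monoid_def .
qed

text \<open>The action on arrows is defined as a union over all representatives of a class. As
  \<open>f\<close> preserves the relation, the sets in this union coincide, and the union is
  nonempty because \<open>a\<close> represents its own class; it therefore collapses to a single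
  class.\<close>

lemma cancel_amap_class:
  assumes A: "comm_monoid A" and B: "comm_monoid B" and f: "f \<in> monoid_hom A B"
    and a: "a \<in> carrier A"
  shows "amap cancel_fctr A B f (cancel_rel A `` {a}) = cancel_rel B `` {f a}"
proof -
  have "cancel_rel B `` {f x} = cancel_rel B `` {f a}" if "x \<in> cancel_rel A `` {a}" for x
    using cancel_class_eq[OF B cancel_rel_hom[OF f]] that by blast
  moreover have "a \<in> cancel_rel A `` {a}"
    using congruence_equiv[OF cancel_rel_congruence[OF A]] a by (auto simp: equiv_def refl_on_def)
  ultimately have "(\<Union>x \<in> cancel_rel A `` {a}. cancel_rel B `` {f x}) = cancel_rel B `` {f a}"
    by blast
  then show ?thesis
    using monoid_homD(1)[OF cancel_class_hom[OF A] a] by (simp add: cancel_fctr_def)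
qed

text \<open>The homomorphism laws are not verified on the union formula. That formula is identified
  with the arrow which \<open>cancel_factor\<close> yields for the homomorphism sending
  \<open>a\<close> to the class of \<open>f a\<close>.\<close>

lemma cancel_amap_arr:
  assumes A: "comm_monoid A" and B: "comm_monoid B" and f: "f \<in> monoid_hom A B"
  shows "amap cancel_fctr A B f \<in> monoid_arr (cancel_monoid A) (cancel_monoid B)"
proof -
  note hom = monoid_hom_comp[OF f cancel_class_hom[OF B]]
  obtain \<gamma> where \<gamma>: "\<gamma> \<in> monoid_arr (cancel_monoid A) (cancel_monoid B)"
    "\<And>a. a \<in> carrier A \<Longrightarrow> \<gamma> (cancel_rel A `` {a}) = cancel_rel B `` {f a}"
    using cancel_factor[OF A comm_monoid_cancel_cancel_monoid[OF B] hom] by blast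
  have "amap cancel_fctr A B f = \<gamma>"
  proof (rule extensionalityI[of _ "carrier (cancel_monoid A)"])
    fix X assume "X \<in> carrier (cancel_monoid A)"
    then show "amap cancel_fctr A B f X = \<gamma> X"
      by (rule cancel_monoid_carrierE[OF A]) (simp add: cancel_amap_class[OF A B f] \<gamma>(2))
  qed (use \<gamma>(1) in \<open>simp_all add: cancel_fctr_def monoid_arr_def\<close>)
  then show ?thesis using \<gamma>(1) by simp
qed

lemma is_fctr_cancel: "is_fctr AbMon CAbMon cancel_fctr"
  unfolding is_fctr_def
proof (intro conjI ballI)
  fix A :: "'a monoid" assume "A \<in> Obj AbMon"
  then have A: "comm_monoid A" by (simp add: AbMon_def)
  then have m: "monoid A" and mc: "monoid (cancel_monoid A)"
    using comm_monoid_cancel_cancel_monoid[OF A]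
    by (simp_all add: comm_monoid_def comm_monoid_cancel_def)
  show "omap cancel_fctr A \<in> Obj CAbMon"
    using comm_monoid_cancel_cancel_monoid[OF A] by (simp add: CAbMon_def cancel_fctr_def)
  note id = monoid_arrD[OF ident_monoid_arr[OF m]]
  have "amap cancel_fctr A A (\<lambda>x \<in> carrier A. x) = (\<lambda>X \<in> carrier (cancel_monoid A). X)"
    by (rule cancel_hom_eqI[OF A cancel_amap_arr[OF A A id] ident_monoid_arr[OF mc]])
      (simp add: cancel_amap_class[OF A A id] monoid_homD(1)[OF cancel_class_hom[OF A]]
        del: Image_singleton_iff)
  then show "amap cancel_fctr A A (Ident AbMon A) = Ident CAbMon (omap cancel_fctr A)"
    by (simp add: AbMon_def CAbMon_def cancel_fctr_def)
next
  fix A B :: "'a monoid" and f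
  assume "A \<in> Obj AbMon" "B \<in> Obj AbMon" "f \<in> Arr AbMon A B"
  then show "amap cancel_fctr A B f \<in> Arr CAbMon (omap cancel_fctr A) (omap cancel_fctr B)"
    using cancel_amap_arr[OF _ _ monoid_arrD, of A B f]
    by (simp add: AbMon_def CAbMon_def cancel_fctr_def)
next
  fix A B C :: "'a monoid" and f g
  assume "A \<in> Obj AbMon" "B \<in> Obj AbMon" "C \<in> Obj AbMon"
    and "f \<in> Arr AbMon A B" "g \<in> Arr AbMon B C"
  then have *: "comm_monoid A" "comm_monoid B" "comm_monoid C"
    and f: "f \<in> monoid_arr A B" and g: "g \<in> monoid_arr B C"
    by (simp_all add: AbMon_def)
  note fh = monoid_arrD[OF f] and gh = monoid_arrD[OF g]
  have m: "monoid A" "monoid (cancel_monoid A)"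
    using * comm_monoid_cancel_cancel_monoid[OF *(1)]
    by (simp_all add: comm_monoid_def comm_monoid_cancel_def)
  have gf: "compose (carrier A) g f \<in> monoid_arr A C"
    by (rule compose_monoid_arr[OF m(1) f g])
  have "amap cancel_fctr A C (compose (carrier A) g f) =
    compose (carrier (cancel_monoid A)) (amap cancel_fctr B C g) (amap cancel_fctr A B f)"
    by (rule cancel_hom_eqI[OF *(1) cancel_amap_arr[OF *(1,3) monoid_arrD[OF gf]]
          compose_monoid_arr[OF m(2) cancel_amap_arr[OF *(1,2) fh] cancel_amap_arr[OF *(2,3) gh]]])
      (simp add: compose_eq monoid_homD(1)[OF fh] monoid_homD(1)[OF cancel_class_hom[OF *(1)]]
        cancel_amap_class[OF *(1,2) fh] cancel_amap_class[OF *(2,3) gh]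
        cancel_amap_class[OF *(1,3) monoid_arrD[OF gf]] del: Image_singleton_iff)
  then show "amap cancel_fctr A C (Comp AbMon A B C g f) =
    Comp CAbMon (omap cancel_fctr A) (omap cancel_fctr B) (omap cancel_fctr C)
      (amap cancel_fctr B C g) (amap cancel_fctr A B f)"
    by (simp add: AbMon_def CAbMon_def cancel_fctr_def)
qed

lemma is_fctr_comp: "is_fctr C D F \<Longrightarrow> is_fctr D E G \<Longrightarrow> is_fctr C E (G \<circ>\<^sub>F F)"
  unfolding is_fctr_def fctr_comp_def by simp


section \<open>Factorizations of balanced maps\<close>

text \<open>This and the next three lemmas read closure facts off the category axioms already
  proved. All semimodules involved in one of them share an element type, as the objects of one such
  category do.\<close>

lemma rlinear_arr_ident:
  fixes M :: "('s, 'm) rsemimod"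
  assumes "right_semimodule S M"
  shows "(\<lambda>x \<in> carrier M. x) \<in> rlinear_arr S M M"
proof -
  have "is_category (right_semimodules S :: (('s, 'm) rsemimod, _) cat)"
    by (rule is_category_right_semimodules)
  then show ?thesis
    using assms unfolding is_category_def right_semimodules_def by simp
qed

lemma rlinear_arr_compose:
  fixes M M' M'' :: "('s, 'm) rsemimod"
  assumes "right_semimodule S M" "right_semimodule S M'" "right_semimodule S M''"
    and "f \<in> rlinear_arr S M M'" "g \<in> rlinear_arr S M' M''"
  shows "compose (carrier M) g f \<in> rlinear_arr S M M''"
proof -
  have "is_category (right_semimodules S :: (('s, 'm) rsemimod, _) cat)"
    by (rule is_category_right_semimodules)
  then show ?thesis
    using assms unfolding is_category_def right_semimodules_def by simp
qed

lemma llinear_arr_ident: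
  fixes N :: "('s, 'n) lsemimod"
  assumes "left_semimodule S N"
  shows "(\<lambda>x \<in> carrier N. x) \<in> llinear_arr S N N"
proof -
  have "is_category (left_semimodules S :: (('s, 'n) lsemimod, _) cat)"
    by (rule is_category_left_semimodules)
  then show ?thesis
    using assms unfolding is_category_def left_semimodules_def by simp
qed

lemma llinear_arr_compose:
  fixes N N' N'' :: "('s, 'n) lsemimod"
  assumes "left_semimodule S N" "left_semimodule S N'" "left_semimodule S N''"
    and "f \<in> llinear_arr S N N'" "g \<in> llinear_arr S N' N''"
  shows "compose (carrier N) g f \<in> llinear_arr S N N''"
proof -
  have "is_category (left_semimodules S :: (('s, 'n) lsemimod, _) cat)"
    by (rule is_category_left_semimodules)
  then show ?thesis
    using assms unfolding is_category_def left_semimodules_def by simp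
qed

text \<open>Linearity of \<open>f\<close> and \<open>g\<close> lets a scalar pass through them
  before the balance condition of \<beta> applies. This makes the universal property applicable to
  the map that defines a tensor functor on an arrow.\<close>

lemma balanced_precompose:
  assumes \<beta>: "balanced S M' N' G \<beta>" and f: "f \<in> rlinear_arr S M M'" and g: "g \<in> llinear_arr S N N'"
  shows "balanced S M N G (\<lambda>m n. \<beta> (f m) (g n))"
proof -
  have fh: "f \<in> monoid_hom M M'" and gh: "g \<in> monoid_hom N N'"
    using f g by (simp_all add: rlinear_arr_def llinear_arr_def monoid_arr_def)
  have "(\<lambda>m. \<beta> (f m) (g n)) \<in> monoid_hom M G" if "n \<in> carrier N" for n
    using monoid_hom_comp[OF fh, of "\<lambda>m. \<beta> m (g n)" G] \<beta> monoid_homD(1)[OF gh that]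
    by (simp add: balanced_def)
  moreover have "(\<lambda>n. \<beta> (f m) (g n)) \<in> monoid_hom N G" if "m \<in> carrier M" for m
    using monoid_hom_comp[OF gh, of "\<lambda>n. \<beta> (f m) n" G] \<beta> monoid_homD(1)[OF fh that]
    by (simp add: balanced_def)
  ultimately show ?thesis
    using \<beta> f g monoid_homD(1)[OF fh] monoid_homD(1)[OF gh]
    by (simp add: balanced_def rlinear_arr_def llinear_arr_def)
qed

lemma balanced_postcompose:
  assumes "balanced S M N G \<beta>" and h: "h \<in> monoid_hom G H"
  shows "balanced S M N H (\<lambda>m n. h (\<beta> m n))"
  using assms(1) unfolding balanced_def by (simp add: monoid_hom_comp[OF _ h])

lemma factorizations_ident:
  "monoid T \<Longrightarrow> balanced S M N T \<tau> \<Longrightarrow> (\<lambda>x \<in> carrier T. x) \<in> factorizations M N T \<tau> T \<tau>"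
  by (simp add: factorizations_def ident_monoid_arr balanced_closed)

lemma factorizations_compose:
  assumes "monoid T" and \<tau>: "balanced S M N T \<tau>" and "\<gamma> \<in> factorizations M N T \<tau> G \<beta>"
    and "h \<in> monoid_arr G H"
  shows "compose (carrier T) h \<gamma> \<in> factorizations M N T \<tau> H (\<lambda>m n. h (\<beta> m n))"
  using assms balanced_closed[OF \<tau>]
  by (auto simp: factorizations_def compose_eq intro: compose_monoid_arr)

text \<open>Only values on the carriers are tested. This matters because \<open>compose\<close> and
  restricted identities are \<open>undefined\<close> elsewhere, so the maps to be compared need not
  be equal as functions.\<close>

lemma factorizations_cong:
  "(\<And>m n. m \<in> carrier M \<Longrightarrow> n \<in> carrier N \<Longrightarrow> \<beta> m n = \<beta>' m n) \<Longrightarrow>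
    factorizations M N T \<tau> G \<beta> = factorizations M N T \<tau> G \<beta>'"
  by (auto simp: factorizations_def)

section \<open>Isomorphisms and functors from universal properties\<close>

text \<open>Each composite of \<phi> and \<psi> factors the universal map of its own object through
  itself, as the identity does, so uniqueness makes both composites identities. Uniqueness is
  assumed only for these self-factorizations: \<open>T\<close> and \<open>T'\<close> may have
  different types, and an assumption cannot be polymorphic in its target.\<close>

lemma iso_of_universal:
  assumes T: "monoid T" "balanced S M N T \<tau>" and T': "monoid T'" "balanced S M N T' \<tau>'"
    and uniq: "\<exists>!\<gamma>. \<gamma> \<in> factorizations M N T \<tau> T \<tau>"
    and uniq': "\<exists>!\<gamma>. \<gamma> \<in> factorizations M N T' \<tau>' T' \<tau>'"
    and \<phi>: "\<phi> \<in> factorizations M N T \<tau> T' \<tau>'" and \<psi>: "\<psi> \<in> factorizations M N T' \<tau>' T \<tau>"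
  shows "\<phi> \<in> iso T T'"
proof -
  have arr: "\<phi> \<in> monoid_arr T T'" "\<psi> \<in> monoid_arr T' T"
    and val: "\<And>m n. m \<in> carrier M \<Longrightarrow> n \<in> carrier N \<Longrightarrow> \<psi> (\<tau>' m n) = \<tau> m n"
      "\<And>m n. m \<in> carrier M \<Longrightarrow> n \<in> carrier N \<Longrightarrow> \<phi> (\<tau> m n) = \<tau>' m n"
    using \<phi> \<psi> by (simp_all add: factorizations_def)
  have "compose (carrier T) \<psi> \<phi> \<in> factorizations M N T \<tau> T \<tau>"
    using factorizations_compose[OF T \<phi> arr(2)]
      factorizations_cong[of M N "\<lambda>m n. \<psi> (\<tau>' m n)" \<tau> T \<tau> T] val by simp
  then have 1: "compose (carrier T) \<psi> \<phi> = (\<lambda>x \<in> carrier T. x)"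
    using uniq factorizations_ident[OF T] by blast
  have "compose (carrier T') \<phi> \<psi> \<in> factorizations M N T' \<tau>' T' \<tau>'"
    using factorizations_compose[OF T' \<psi> arr(1)]
      factorizations_cong[of M N "\<lambda>m n. \<phi> (\<tau> m n)" \<tau>' T' \<tau>' T'] val by simp
  then have 2: "compose (carrier T') \<phi> \<psi> = (\<lambda>x \<in> carrier T'. x)"
    using uniq' factorizations_ident[OF T'] by blast
  have "bij_betw \<phi> (carrier T) (carrier T')"
  proof (rule bij_betwI[where g = \<psi>])
    show "\<psi> (\<phi> x) = x" if "x \<in> carrier T" for x
      using fun_cong[OF 1, of x] that by (simp add: compose_eq)
    show "\<phi> (\<psi> y) = y" if "y \<in> carrier T'" for y
      using fun_cong[OF 2, of y] that by (simp add: compose_eq)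
  qed (use arr in \<open>auto intro: monoid_homD(1)[OF monoid_arrD]\<close>)
  then show ?thesis using arr by (simp add: iso_def monoid_arr_def monoid_hom_def)
qed

text \<open>One argument serves both tensor products; \<open>K\<close> is the class of monoids
  against which \<open>T\<close> is universal. Functoriality is uniqueness: the two sides of each
  functor law factor the same balanced map. Since \<open>T\<close> takes values in \<open>K\<close>,
  testing targets of the type of \<open>T\<close> suffices.\<close>

lemma is_fctr_universal:
  fixes S :: "('s, 'z) ring_scheme"
    and T :: "('s, 'm) rsemimod \<Rightarrow> ('s, 'n) lsemimod \<Rightarrow> 't monoid"
  assumes mon: "\<And>M N. right_semimodule S M \<Longrightarrow> left_semimodule S N \<Longrightarrow> monoid (T M N)"
    and obj: "\<And>M N. right_semimodule S M \<Longrightarrow> left_semimodule S N \<Longrightarrow> T M N \<in> K"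
    and bal: "\<And>M N. right_semimodule S M \<Longrightarrow> left_semimodule S N \<Longrightarrow>
      balanced S M N (T M N) (\<tau> M N)"
    and univ: "\<And>M N G \<beta>. right_semimodule S M \<Longrightarrow> left_semimodule S N \<Longrightarrow> G \<in> K \<Longrightarrow>
      balanced S M N G \<beta> \<Longrightarrow> \<exists>!\<gamma>. \<gamma> \<in> factorizations M N (T M N) (\<tau> M N) G \<beta>"
  shows "is_fctr (right_semimodules S \<times>\<^sub>C left_semimodules S) (AbMon \<lparr>Obj := K\<rparr>)
    \<lparr> omap = (\<lambda>(M, N). T M N),
      amap = (\<lambda>(M, N) (M', N') (f, g). THE \<gamma>. \<gamma> \<in> factorizations M N
        (T M N) (\<tau> M N) (T M' N') (\<lambda>m n. \<tau> M' N' (f m) (g n))) \<rparr>"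
proof -
  \<comment> \<open>A curried name for the arrow action. The description is under control only for
    linear \<open>f\<close> and \<open>g\<close>, where \<open>ex1\<close> supplies unique
    existence.\<close>
  define am where "am M N M' N' f g = (THE \<gamma>. \<gamma> \<in> factorizations M N
    (T M N) (\<tau> M N) (T M' N') (\<lambda>m n. \<tau> M' N' (f m) (g n)))" for M N M' N' f g
  have ex1: "\<exists>!\<gamma>. \<gamma> \<in> factorizations M N (T M N) (\<tau> M N) (T M' N') (\<lambda>m n. \<tau> M' N' (f m) (g n))"
    if "right_semimodule S M" "left_semimodule S N" "right_semimodule S M'" "left_semimodule S N'"
      "f \<in> rlinear_arr S M M'" "g \<in> llinear_arr S N N'" for M N M' N' f g
    by (intro univ obj balanced_precompose[OF bal] that)
  have am: "am M N M' N' f g \<in> factorizations M N (T M N) (\<tau> M N) (T M' N') (\<lambda>m n. \<tau> M' N' (f m) (g n))"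
    if "right_semimodule S M" "left_semimodule S N" "right_semimodule S M'" "left_semimodule S N'"
      "f \<in> rlinear_arr S M M'" "g \<in> llinear_arr S N N'" for M N M' N' f g
    unfolding am_def by (rule theI'[OF ex1[OF that]])
  have am_arr: "am M N M' N' f g \<in> monoid_arr (T M N) (T M' N')"
    if "right_semimodule S M" "left_semimodule S N" "right_semimodule S M'" "left_semimodule S N'"
      "f \<in> rlinear_arr S M M'" "g \<in> llinear_arr S N N'" for M N M' N' f g
    using am[OF that] by (simp add: factorizations_def)
  have id: "am M N M N (\<lambda>x \<in> carrier M. x) (\<lambda>x \<in> carrier N. x) = (\<lambda>x \<in> carrier (T M N). x)"
    if MN: "right_semimodule S M" "left_semimodule S N" for M N
  proof -
    from am[OF MN MN rlinear_arr_ident[OF MN(1)] llinear_arr_ident[OF MN(2)]]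
    have "am M N M N (\<lambda>x \<in> carrier M. x) (\<lambda>x \<in> carrier N. x)
        \<in> factorizations M N (T M N) (\<tau> M N) (T M N) (\<tau> M N)"
      by (simp add: factorizations_def)
    then show ?thesis
      using univ[OF MN obj[OF MN] bal[OF MN]] factorizations_ident[OF mon[OF MN] bal[OF MN]]
      by blast
  qed
  have comp: "am M N M'' N'' (compose (carrier M) f' f) (compose (carrier N) g' g) =
      compose (carrier (T M N)) (am M' N' M'' N'' f' g') (am M N M' N' f g)"
    if MN: "right_semimodule S M" "left_semimodule S N"
      and MN': "right_semimodule S M'" "left_semimodule S N'"
      and MN'': "right_semimodule S M''" "left_semimodule S N''"
      and fg: "f \<in> rlinear_arr S M M'" "g \<in> llinear_arr S N N'"
      and fg': "f' \<in> rlinear_arr S M' M''" "g' \<in> llinear_arr S N' N''"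
    for M N M' N' M'' N'' f g f' g'
  proof -
    note cfg = rlinear_arr_compose[OF MN(1) MN'(1) MN''(1) fg(1) fg'(1)]
      llinear_arr_compose[OF MN(2) MN'(2) MN''(2) fg(2) fg'(2)]
    let ?\<beta> = "\<lambda>m n. \<tau> M'' N'' (compose (carrier M) f' f m) (compose (carrier N) g' g n)"
    \<comment> \<open>The composite arrow is evaluated on pure tensors: the second arrow is known at
      the images of \<open>f m\<close> and \<open>g n\<close> because these lie in the carriers of
      \<open>M'\<close> and \<open>N'\<close>.\<close>
    have "am M' N' M'' N'' f' g' (\<tau> M' N' (f m) (g n)) = ?\<beta> m n"
      if "m \<in> carrier M" "n \<in> carrier N" for m n
    proof -
      have "f m \<in> carrier M'" "g n \<in> carrier N'"
        using fg that
        by (auto simp: rlinear_arr_def llinear_arr_def intro: monoid_homD(1)[OF monoid_arrD])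
      then show ?thesis
        using am[OF MN' MN'' fg'] that by (simp add: factorizations_def compose_eq)
    qed
    then have "compose (carrier (T M N)) (am M' N' M'' N'' f' g') (am M N M' N' f g)
        \<in> factorizations M N (T M N) (\<tau> M N) (T M'' N'') ?\<beta>"
      using factorizations_compose[OF mon[OF MN] bal[OF MN] am[OF MN MN' fg] am_arr[OF MN' MN'' fg']]
      by (subst factorizations_cong[of _ _ ?\<beta>]) auto
    then show ?thesis using ex1[OF MN MN'' cfg] am[OF MN MN'' cfg] by blast
  qed
  have "is_fctr (right_semimodules S \<times>\<^sub>C left_semimodules S) (AbMon \<lparr>Obj := K\<rparr>)
    \<lparr> omap = (\<lambda>(M, N). T M N), amap = (\<lambda>(M, N) (M', N') (f, g). am M N M' N' f g) \<rparr>"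
    unfolding is_fctr_def
    by (auto simp: prod_cat_def right_semimodules_def left_semimodules_def AbMon_def
        obj am_arr id comp)
  then show ?thesis unfolding am_def .
qed

lemma is_fctr_tensor:
  "is_fctr (right_semimodules S \<times>\<^sub>C left_semimodules S) AbMon (tensor_fctr S)"
proof -
  \<comment> \<open>\<open>AbMon\<close> is put in the form of an updated record, the form in which
    \<open>CAbMon\<close> is defined, so that the general lemma applies.\<close>
  have "AbMon = AbMon \<lparr>Obj := {A. comm_monoid A}\<rparr>" by (simp add: AbMon_def)
  moreover have "is_fctr (right_semimodules S \<times>\<^sub>C left_semimodules S)
      (AbMon \<lparr>Obj := {A. comm_monoid A}\<rparr>) (tensor_fctr S)"
    unfolding tensor_fctr_def
    by (rule is_fctr_universal)
      (simp_all add: tensor_universal(1,2) tensor_universal(3) comm_monoid.axioms(1))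
  ultimately show ?thesis by metis
qed

lemma is_fctr_takahashi:
  "is_fctr (right_semimodules S \<times>\<^sub>C left_semimodules S) CAbMon (takahashi_fctr S)"
  unfolding takahashi_fctr_def CAbMon_def
  by (rule is_fctr_universal)
    (simp_all add: takahashi_universal(1,2) takahashi_universal(3) comm_monoid.axioms(1)
      comm_monoid_cancel.axioms(2))

text \<open>The universal properties of the tensor product and of c are chained. A balanced map
  factors through the tensor product as \<open>h\<close>, and \<open>h\<close> factors through c
  because the target is cancellative. For uniqueness, any competitor composed with the class map is
  again a factorization through the tensor product, hence equal to \<open>h\<close>, which fixes the
  competitor on all classes.\<close>

lemma cancel_tensor_universal:
  assumes M: "right_semimodule S M" and N: "left_semimodule S N"
  defines "\<tau> \<equiv> \<lambda>m n. cancel_rel (tensor S M N) `` {tensor_map S M N m n}"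
  shows "balanced S M N (cancel_monoid (tensor S M N)) \<tau>"
    and "\<And>(G :: ('g, 'x) monoid_scheme) \<beta>. comm_monoid_cancel G \<Longrightarrow> balanced S M N G \<beta> \<Longrightarrow>
      \<exists>!\<gamma>. \<gamma> \<in> factorizations M N (cancel_monoid (tensor S M N)) \<tau> G \<beta>"
proof -
  let ?T = "tensor S M N"
  note T = tensor_universal(1)[OF M N] and bal = tensor_universal(2)[OF M N]
  note q = cancel_class_hom[OF T]
  show "balanced S M N (cancel_monoid ?T) \<tau>"
    unfolding \<tau>_def by (rule balanced_postcompose[OF bal q])
  fix G :: "('g, 'x) monoid_scheme" and \<beta>
  assume G: "comm_monoid_cancel G" and \<beta>: "balanced S M N G \<beta>"
  have uniq: "\<exists>!\<gamma>. \<gamma> \<in> factorizations M N ?T (tensor_map S M N) G \<beta>"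
    by (rule tensor_universal(3)[OF M N comm_monoid_cancel.axioms(2)[OF G] \<beta>])
  then obtain h where h: "h \<in> factorizations M N ?T (tensor_map S M N) G \<beta>" by blast
  then have "h \<in> monoid_hom ?T G" by (simp add: factorizations_def monoid_arr_def)
  then obtain \<gamma> where \<gamma>: "\<gamma> \<in> monoid_arr (cancel_monoid ?T) G"
    "\<And>t. t \<in> carrier ?T \<Longrightarrow> \<gamma> (cancel_rel ?T `` {t}) = h t"
    using cancel_factor[OF T G] by blast
  show "\<exists>!\<gamma>. \<gamma> \<in> factorizations M N (cancel_monoid ?T) \<tau> G \<beta>"
  proof (rule ex1I)
    show "\<gamma> \<in> factorizations M N (cancel_monoid ?T) \<tau> G \<beta>"
      using \<gamma> h balanced_closed[OF bal] by (simp add: factorizations_def \<tau>_def)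
    fix \<gamma>' assume \<gamma>': "\<gamma>' \<in> factorizations M N (cancel_monoid ?T) \<tau> G \<beta>"
    then have arr: "\<gamma>' \<in> monoid_arr (cancel_monoid ?T) G" by (simp add: factorizations_def)
    \<comment> \<open>The restriction to the carrier makes this composite extensional, as membership
      in \<open>factorizations\<close> demands; only then can it be compared with
      \<open>h\<close>.\<close>
    let ?h = "\<lambda>t \<in> carrier ?T. \<gamma>' (cancel_rel ?T `` {t})"
    have "?h \<in> monoid_hom ?T G"
      using monoid_hom_comp[OF q monoid_arrD[OF arr]] T
      by (auto simp: monoid_hom_def hom_def comm_monoid_def monoid.m_closed monoid.one_closed Pi_iff
          simp del: Image_singleton_iff)
    then have "?h \<in> factorizations M N ?T (tensor_map S M N) G \<beta>"
      using \<gamma>' balanced_closed[OF bal]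
      by (simp add: factorizations_def monoid_arr_def \<tau>_def)
    then have eq: "?h = h" using uniq h by blast
    have "\<gamma>' (cancel_rel ?T `` {t}) = h t" if "t \<in> carrier ?T" for t
      using fun_cong[OF eq, of t] that by simp
    then show "\<gamma>' = \<gamma>" by (intro cancel_hom_eqI[OF T arr \<gamma>(1)]) (simp add: \<gamma>(2))
  qed
qed

section \<open>The natural isomorphism\<close>

theorem theorem2p3:
  fixes S :: "('s, 'z) ring_scheme"
  assumes "semiring S" and "\<one>\<^bsub>S\<^esub> \<noteq> \<zero>\<^bsub>S\<^esub>"
  shows "\<exists>\<eta> :: ('s, 'm) rsemimod \<times> ('s, 'n) lsemimod
              \<Rightarrow> ('m \<times> 'n) multiset set \<Rightarrow> ('m \<times> 'n) multiset set set.
    CAbMon_natural_iso (right_semimodules S \<times>\<^sub>C left_semimodules S)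
      (takahashi_fctr S) (cancel_fctr \<circ>\<^sub>F tensor_fctr S) \<eta> \<and>
    (\<forall>M N. right_semimodule S M \<longrightarrow> left_semimodule S N \<longrightarrow>
       \<eta> (M, N) \<in> iso (takahashi S M N) (cancel_monoid (tensor S M N)))"
proof -
  let ?C = "right_semimodules S \<times>\<^sub>C left_semimodules S"
  let ?T = "\<lambda>M N. takahashi S M N" and ?\<tau> = "\<lambda>M N. takahashi_map S M N"
  let ?U = "\<lambda>M N. cancel_monoid (tensor S M N)"
  let ?\<upsilon> = "\<lambda>M N m n. cancel_rel (tensor S M N) `` {tensor_map S M N m n}"
  let ?fac = "\<lambda>M N. factorizations M N (?T M N) (?\<tau> M N) (?U M N) (?\<upsilon> M N)"
  \<comment> \<open>The component at a pair is the factorization of the balanced map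
    \<open>?\<upsilon>\<close> through Takahashi's product. It exists and is unique because the
    target of \<open>?\<upsilon>\<close> is cancellative.\<close>
  define \<eta> :: "('s, 'm) rsemimod \<times> ('s, 'n) lsemimod
      \<Rightarrow> ('m \<times> 'n) multiset set \<Rightarrow> ('m \<times> 'n) multiset set set"
    where "\<eta> = (\<lambda>(M, N). THE \<gamma>. \<gamma> \<in> ?fac M N)"
  have U: "comm_monoid_cancel (?U M N)" "monoid (?U M N)" and T: "monoid (?T M N)"
    and \<eta>: "\<eta> (M, N) \<in> ?fac M N"
    if MN: "right_semimodule S M" "left_semimodule S N"
    for M :: "('s, 'm) rsemimod" and N :: "('s, 'n) lsemimod"
  proof -
    show U: "comm_monoid_cancel (?U M N)"
      by (rule comm_monoid_cancel_cancel_monoid[OF tensor_universal(1)[OF MN]])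
    then show "monoid (?U M N)" by (simp add: comm_monoid_cancel_def comm_monoid_def)
    show "monoid (?T M N)"
      using takahashi_universal(1)[OF MN] by (simp add: comm_monoid_cancel_def comm_monoid_def)
    show "\<eta> (M, N) \<in> ?fac M N"
      unfolding \<eta>_def prod.case
      by (rule theI'[OF takahashi_universal(3)[OF MN U cancel_tensor_universal(1)[OF MN]]])
  qed
  have \<eta>_arr: "\<eta> (M, N) \<in> monoid_arr (?T M N) (?U M N)"
    if MN: "right_semimodule S M" "left_semimodule S N" for M N
    using \<eta>[OF MN] by (simp add: factorizations_def)
  have iso: "\<eta> (M, N) \<in> iso (?T M N) (?U M N)"
    if MN: "right_semimodule S M" "left_semimodule S N" for M N
  proof -
    note t = takahashi_universal[OF MN] and u = cancel_tensor_universal[OF MN]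
    \<comment> \<open>The candidate inverse comes from the opposite direction: Takahashi's product
      is itself a cancellative target for the universal property of c(M \<otimes> N).\<close>
    obtain \<psi> where "\<psi> \<in> factorizations M N (?U M N) (?\<upsilon> M N) (?T M N) (?\<tau> M N)"
      using u(2)[OF t(1,2)] by blast
    then show ?thesis
      by (rule iso_of_universal[OF T[OF MN] t(2) U(2)[OF MN] u(1) t(3)[OF t(1,2)]
            u(2)[OF U(1)[OF MN] u(1)] \<eta>[OF MN]])
  qed
  note F = is_fctr_takahashi[of S]
    and G = is_fctr_comp[OF is_fctr_tensor is_fctr_cancel, of S]
  have nat: "compose (carrier (?T M N)) (\<eta> (M', N')) (amap (takahashi_fctr S) (M, N) (M', N') (f, g))
      = compose (carrier (?T M N)) (amap (cancel_fctr \<circ>\<^sub>F tensor_fctr S) (M, N) (M', N') (f, g)) (\<eta> (M, N))"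
    if MN: "right_semimodule S M" "left_semimodule S N"
      and MN': "right_semimodule S M'" "left_semimodule S N'"
      and fg: "f \<in> rlinear_arr S M M'" "g \<in> llinear_arr S N N'" for M N M' N' f g
  proof -
    note t = takahashi_universal[OF MN] and t' = takahashi_universal[OF MN']
      and s = tensor_universal[OF MN] and s' = tensor_universal[OF MN']
      and u' = cancel_tensor_universal[OF MN']
    have fg_in: "f m \<in> carrier M'" "g n \<in> carrier N'" if "m \<in> carrier M" "n \<in> carrier N" for m n
      using fg that
      by (auto simp: rlinear_arr_def llinear_arr_def intro: monoid_homD(1)[OF monoid_arrD])
    let ?Tfg = "amap (takahashi_fctr S) (M, N) (M', N') (f, g)"
    let ?Sfg = "amap (tensor_fctr S) (M, N) (M', N') (f, g)"
    let ?Ufg = "amap cancel_fctr (tensor S M N) (tensor S M' N') ?Sfg"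
    have Tfg: "?Tfg \<in> factorizations M N (?T M N) (?\<tau> M N) (?T M' N') (\<lambda>m n. ?\<tau> M' N' (f m) (g n))"
      unfolding takahashi_fctr_def fctr.simps prod.case
      by (rule theI'[OF t(3)[OF t'(1) balanced_precompose[OF t'(2) fg]]])
    have Sfg: "?Sfg \<in> factorizations M N (tensor S M N) (tensor_map S M N) (tensor S M' N')
        (\<lambda>m n. tensor_map S M' N' (f m) (g n))"
      unfolding tensor_fctr_def fctr.simps prod.case
      by (rule theI'[OF s(3)[OF s'(1) balanced_precompose[OF s'(2) fg]]])
    then have Sfg_hom: "?Sfg \<in> monoid_hom (tensor S M N) (tensor S M' N')"
      by (simp add: factorizations_def monoid_arr_def)
    \<comment> \<open>On the class of a pure tensor, c of the tensor arrow first applies that arrow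
      to the representative, where its value is prescribed by its defining factorization.\<close>
    have Ufg: "?Ufg (?\<upsilon> M N m n) = ?\<upsilon> M' N' (f m) (g n)"
      if "m \<in> carrier M" "n \<in> carrier N" for m n
      using cancel_amap_class[OF s(1) s'(1) Sfg_hom balanced_closed[OF s(2) that]] Sfg that
      by (simp add: factorizations_def)
    \<comment> \<open>Both paths around the naturality square send the image of
      \<open>(m, n)\<close> to the class of the pure tensor of \<open>f m\<close> and
      \<open>g n\<close>. They are thus factorizations of one balanced map into a cancellative
      monoid, and uniqueness makes them equal.\<close>
    let ?fac' = "factorizations M N (?T M N) (?\<tau> M N) (?U M' N') (\<lambda>m n. ?\<upsilon> M' N' (f m) (g n))"
    have "compose (carrier (?T M N)) (\<eta> (M', N')) ?Tfg \<in> ?fac'"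
      using factorizations_compose[OF T[OF MN] t(2) Tfg \<eta>_arr[OF MN']] \<eta>[OF MN'] fg_in
      by (simp add: factorizations_def)
    moreover have "compose (carrier (?T M N)) ?Ufg (\<eta> (M, N)) \<in> ?fac'"
      using factorizations_compose[OF T[OF MN] t(2) \<eta>[OF MN] cancel_amap_arr[OF s(1) s'(1) Sfg_hom]] Ufg
      by (simp add: factorizations_def)
    ultimately have "compose (carrier (?T M N)) (\<eta> (M', N')) ?Tfg
        = compose (carrier (?T M N)) ?Ufg (\<eta> (M, N))"
      using t(3)[OF U(1)[OF MN'] balanced_precompose[OF u'(1) fg]] by blast
    then show ?thesis by (simp add: fctr_comp_def tensor_fctr_def)
  qed
  have "CAbMon_natural_iso ?C (takahashi_fctr S) (cancel_fctr \<circ>\<^sub>F tensor_fctr S) \<eta>"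
    unfolding CAbMon_natural_iso_def
  proof (intro conjI ballI F G)
    fix X :: "('s, 'm) rsemimod \<times> ('s, 'n) lsemimod" assume "X \<in> Obj ?C"
    then obtain M N where X: "X = (M, N)" "right_semimodule S M" "left_semimodule S N"
      by (auto simp: prod_cat_def right_semimodules_def left_semimodules_def)
    then show "\<eta> X \<in> monoid_arr (omap (takahashi_fctr S) X) (omap (cancel_fctr \<circ>\<^sub>F tensor_fctr S) X)
        \<inter> iso (omap (takahashi_fctr S) X) (omap (cancel_fctr \<circ>\<^sub>F tensor_fctr S) X)"
      using \<eta>_arr iso
      by (simp add: takahashi_fctr_def tensor_fctr_def cancel_fctr_def fctr_comp_def)
  next
    fix X Y :: "('s, 'm) rsemimod \<times> ('s, 'n) lsemimod" and f
    assume "X \<in> Obj ?C" "Y \<in> Obj ?C" "f \<in> Arr ?C X Y"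
    then obtain M N M' N' f\<^sub>1 f\<^sub>2 where "X = (M, N)" "Y = (M', N')" "f = (f\<^sub>1, f\<^sub>2)"
      "right_semimodule S M" "left_semimodule S N" "right_semimodule S M'" "left_semimodule S N'"
      "f\<^sub>1 \<in> rlinear_arr S M M'" "f\<^sub>2 \<in> llinear_arr S N N'"
      by (cases X; cases Y; cases f) (simp add: prod_cat_def right_semimodules_def left_semimodules_def)
    moreover have "omap (takahashi_fctr S) (M, N) = ?T M N" by (simp add: takahashi_fctr_def)
    ultimately show "compose (carrier (omap (takahashi_fctr S) X)) (\<eta> Y) (amap (takahashi_fctr S) X Y f)
        = compose (carrier (omap (takahashi_fctr S) X))
            (amap (cancel_fctr \<circ>\<^sub>F tensor_fctr S) X Y f) (\<eta> X)"
      by (simp only: nat)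
  qed
  with iso show ?thesis by blast
qed

end
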